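(* Let a complex triangular matrix $B$ have the size $n\times n$ and be represented as the sum $B=D+N$ of a diagonal matrix $D$ and a strictly triangular matrix $N$. Let $\gamma^->0$ and $\gamma^+>0$ be chosen so that the strip $\{z\in\mathbb C:\,-\gamma^-<\operatorname{Re} z<\gamma^+\}$ is disjoint from the spectrum $\sigma(B)$ of the matrix $B$. Let the norm $\lVert\cdot\rVert$ on the space of complex $n\times n$ matrices be induced by a norm on $\mathbb C^n$ and possess the property $\lVert E\rVert\le\max_i|e_{ii}|$ for any diagonal matrix $E=(e_{ij})$. Put $\gamma=\gamma^-+\gamma^+$. Then for all real $t\neq0$ $$\lVert \mathcal G(B,t)\rVert\le\bigl(\eta(t)e^{-\gamma^-t}+\eta(-t)e^{\gamma^+t}\bigr)\sum_{k=0}^{n-1}\lVert N\rVert^{k}\,\frac{|t|^{k}\sqrt{\gamma|t|}\,e^{\gamma|t|/2}\,K_{-k-\frac12}\left(\frac12\gamma|t|\right)}{\sqrt{\pi}\,k!}.$$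
   Context: For $t\in\mathbb R$, $t\ne0$, and $\lambda\in\mathbb C$ with $\operatorname{Re}\lambda\neq0$, define $g_t(\lambda)$ as follows. If $\operatorname{Re}\lambda<0$, then $g_t(\lambda)=e^{\lambda t}$ for $t>0$ and $g_t(\lambda)=0$ for $t<0$. If $\operatorname{Re}\lambda>0$, then $g_t(\lambda)=0$ for $t>0$ and $g_t(\lambda)=-e^{\lambda t}$ for $t<0$. For fixed $t\ne0$ the function $g_t$ is analytic on $\mathbb C\setminus i\mathbb R$. For a complex $n\times n$ matrix $A$ whose spectrum $\sigma(A)$ does not intersect the imaginary axis, Green's function (of the bounded solutions problem for $x'(t)=Ax(t)+f(t)$, $t\in\mathbb R$) is $$\mathcal G(A,t)=\frac1{2\pi i}\int_\Gamma g_t(\lambda)(\lambda\mathbf 1-A)^{-1}\,d\lambda,\qquad t\neq0,$$ where $\mathbf 1$ is the identity matrix and $\Gamma$ is a (possibly disconnected) positively oriented contour enclosing $\sigma(A)$, such that $\Gamma$ and the region it encloses lie in $\mathbb C\setminus i\mathbb R$. In other words, $\mathcal G(A,t)=g_t(A)$ in the holomorphic functional calculus. $\eta$ is the Heaviside function: $\eta(t)=1$ for $t>0$, $\eta(t)=0$ for $t<0$. $K_\nu$ is the modified Bessel function of the second kind of order $\nu$. By convention $\lVert N\rVert^0=1$. *)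

theory Defs
  imports "HOL-Complex_Analysis.Complex_Analysis"
begin

section \<open>Matrices\<close>

text \<open>
  An \<open>n \<times> n\<close> matrix is an element of \<^typ>\<open>complex ^ 'n ^ 'n\<close> whose finite index type is
  linearly ordered; the order is what gives triangularity a meaning.
\<close>

definition spectrum :: "complex ^ 'n ^ 'n \<Rightarrow> complex set" where
  "spectrum A = {z. \<not> invertible (mat z - A)}"

definition diagonal_matrix :: "complex ^ 'n ^ 'n \<Rightarrow> bool" where
  "diagonal_matrix A \<longleftrightarrow> (\<forall>i j. i \<noteq> j \<longrightarrow> A $ i $ j = 0)"

text \<open>``Triangular'' means upper or lower triangular.\<close>

definition triangular :: "complex ^ 'n::{finite,linorder} ^ 'n::{finite,linorder} \<Rightarrow> bool" where
  "triangular A \<longleftrightarrow> (\<forall>i j. j < i \<longrightarrow> A $ i $ j = 0) \<or> (\<forall>i j. i < j \<longrightarrow> A $ i $ j = 0)"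

definition strictly_triangular :: "complex ^ 'n::{finite,linorder} ^ 'n::{finite,linorder} \<Rightarrow> bool" where
  "strictly_triangular A \<longleftrightarrow> (\<forall>i j. j \<le> i \<longrightarrow> A $ i $ j = 0) \<or> (\<forall>i j. i \<le> j \<longrightarrow> A $ i $ j = 0)"


section \<open>Norms on the coordinate space and the matrix norms they induce\<close>

definition vector_norm :: "(complex ^ 'n \<Rightarrow> real) \<Rightarrow> bool" where
  "vector_norm \<nu> \<longleftrightarrow>
     (\<forall>x. 0 \<le> \<nu> x) \<and> (\<forall>x. \<nu> x = 0 \<longleftrightarrow> x = 0) \<and>
     (\<forall>c x. \<nu> (c *s x) = cmod c * \<nu> x) \<and>
     (\<forall>x y. \<nu> (x + y) \<le> \<nu> x + \<nu> y)"

definition induced_norm :: "(complex ^ 'n \<Rightarrow> real) \<Rightarrow> complex ^ 'n ^ 'n \<Rightarrow> real" where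
  "induced_norm \<nu> A = (SUP x\<in>{x. \<nu> x = 1}. \<nu> (A *v x))"


section \<open>Green's function\<close>

text \<open>The values for \<open>t = 0\<close> and for \<open>Re z = 0\<close> are irrelevant.\<close>

definition green_scalar :: "real \<Rightarrow> complex \<Rightarrow> complex" where
  "green_scalar t z =
     (if Re z < 0 \<and> 0 < t then exp (z * of_real t)
      else if 0 < Re z \<and> t < 0 then - exp (z * of_real t)
      else 0)"

text \<open>
  A possibly disconnected contour is a finite list of pairwise disjoint simple closed piecewise
  continuously differentiable curves. Its winding number about a point is the sum of those of its
  components; it is positively oriented if this sum is always 0 or 1, and the region it encloses
  consists of the points where the sum is 1 (so holes bounded by clockwise curves are allowed).
\<close>

definition contour_winding :: "(real \<Rightarrow> complex) list \<Rightarrow> complex \<Rightarrow> complex" where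
  "contour_winding \<Gamma> z = (\<Sum>p\<leftarrow>\<Gamma>. winding_number p z)"

definition contour_image :: "(real \<Rightarrow> complex) list \<Rightarrow> complex set" where
  "contour_image \<Gamma> = (\<Union>p\<in>set \<Gamma>. path_image p)"

definition positively_oriented_contour :: "(real \<Rightarrow> complex) list \<Rightarrow> bool" where
  "positively_oriented_contour \<Gamma> \<longleftrightarrow>
     (\<forall>p\<in>set \<Gamma>. valid_path p \<and> simple_path p \<and> pathfinish p = pathstart p) \<and>
     distinct \<Gamma> \<and> pairwise (\<lambda>p q. disjnt (path_image p) (path_image q)) (set \<Gamma>) \<and>
     (\<forall>z. z \<notin> contour_image \<Gamma> \<longrightarrow> contour_winding \<Gamma> z \<in> {0, 1})"

definition enclosed_region :: "(real \<Rightarrow> complex) list \<Rightarrow> complex set" where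
  "enclosed_region \<Gamma> = {z. z \<notin> contour_image \<Gamma> \<and> contour_winding \<Gamma> z = 1}"

definition green_contour :: "complex ^ 'n ^ 'n \<Rightarrow> (real \<Rightarrow> complex) list \<Rightarrow> bool" where
  "green_contour A \<Gamma> \<longleftrightarrow>
     positively_oriented_contour \<Gamma> \<and>
     spectrum A \<subseteq> enclosed_region \<Gamma> \<and>
     (contour_image \<Gamma> \<union> enclosed_region \<Gamma>) \<inter> {z. Re z = 0} = {}"

text \<open>
  The contour integral of a matrix-valued function is taken entrywise. By Cauchy's theorem it does
  not depend on which contour \<open>\<Gamma>\<close> is chosen.
\<close>

definition green_function :: "complex ^ 'n ^ 'n \<Rightarrow> real \<Rightarrow> complex ^ 'n ^ 'n" where
  "green_function A t =
     (let \<Gamma> = (SOME \<Gamma>. green_contour A \<Gamma>) in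
      \<chi> i j. 1 / (2 * of_real pi * \<i>) *
        (\<Sum>p\<leftarrow>\<Gamma>. contour_integral p (\<lambda>z. green_scalar t z * matrix_inv (mat z - A) $ i $ j)))"


section \<open>Special functions\<close>

definition heaviside :: "real \<Rightarrow> real" where
  "heaviside t = (if 0 < t then 1 else 0)"

text \<open>
  Modified Bessel functions of real order \<open>\<nu>\<close> and argument \<open>x > 0\<close>: the first kind by its power
  series, the second kind by
  \<open>K\<^sub>\<nu> = \<pi>/2 \<cdot> (I\<^sub>-\<^sub>\<nu> - I\<^sub>\<nu>) / sin (\<nu> \<pi>)\<close>, with the limit in the order if \<open>\<nu>\<close> is an integer.
  The reciprocal Gamma function \<^const>\<open>rGamma\<close> vanishes at the poles of \<open>\<Gamma>\<close>.
\<close>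

definition bessel_I :: "real \<Rightarrow> real \<Rightarrow> real" where
  "bessel_I \<nu> x = (\<Sum>m. rGamma (\<nu> + real m + 1) / fact m * (x / 2) powr (2 * real m + \<nu>))"

definition bessel_K :: "real \<Rightarrow> real \<Rightarrow> real" where
  "bessel_K \<nu> x =
     (let K = (\<lambda>\<mu>. pi / 2 * (bessel_I (- \<mu>) x - bessel_I \<mu> x) / sin (\<mu> * pi))
      in if \<nu> \<in> \<int> then Lim (at \<nu>) K else K \<nu>)"

end

theory Submission
  imports Defs
begin

text \<open>
  Since \<open>N\<close> is strictly triangular, the resolvent of \<open>B\<close> is the finite Neumann sum of
  \<open>R\<^sub>D (N R\<^sub>D)\<^sup>k\<close>, where \<open>R\<^sub>D\<close> is the resolvent of \<open>D\<close>. Applying \<open>g\<^sub>t\<close> to the \<open>k\<close>-th term gives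
  \<open>G\<^sub>k(t)\<close> with \<open>G\<^sub>k' = D G\<^sub>k + N G\<^sub>k\<^sub>-\<^sub>1\<close> for \<open>t \<noteq> 0\<close>; for \<open>k > 0\<close> it is continuous and vanishes at
  infinity, so \<open>G\<^sub>k\<close> is the convolution of \<open>\<G>(D,\<cdot>)\<close> with \<open>N G\<^sub>k\<^sub>-\<^sub>1\<close>. Hence \<open>\<parallel>G\<^sub>k(t)\<parallel>\<close> is at most
  \<open>\<parallel>N\<parallel>\<^sup>k h\<^sub>k(t)\<close>, where \<open>h\<^sub>k\<close> is the \<open>(k+1)\<close>-fold convolution power of the function equal to
  \<open>exp (- \<gamma>\<^sup>- t)\<close> for \<open>t > 0\<close> and to \<open>exp (\<gamma>\<^sup>+ t)\<close> for \<open>t < 0\<close>. These powers are exponentials times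
  explicit polynomials, which are the finite expansions of the Bessel functions of half-integer order.
\<close>

section \<open>Modified Bessel functions of half-integer order\<close>

text \<open>The Bessel functions come from Fourier analysis. The two-sided exponential has transform
  \<gamma> / ((\<gamma>m + i w)(\<gamma>p - i w)). Its powers, once a factor exp ((\<gamma>p -
  \<gamma>m) t / 2) is split off, become powers of 1 / (w^2 + \<gamma>^2 / 4), whose inverse
  transforms are multiples of |t| ^ (k + 1/2) K(\<gamma> |t| / 2) of order k + 1/2. That even factor
  is why one polynomial in |t| serves both signs of t. Two obstacles shape the argument. Diagonal
  entries may repeat, so the entries of the resolvent terms have poles of varying order; rather than
  a closed formula, a class of rational functions closed under division by z - d is used, which is
  all that the passage from k to k + 1 needs. And the convolution integral is never formed: a
  supporting functional of the norm turns the estimate into a scalar differential inequality, solved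
  from minus infinity on the stable coordinates and, after reflecting time, on the unstable ones.
  The hypothesis on diagonal matrices enters there, to bound the diagonal propagators.\<close>

lemma powr_add_nat:
  fixes y :: real assumes "y > 0" shows "y powr (s + real n) = y powr s * y ^ n"
  using assms by (simp add: powr_add powr_realpow)

lemma summable_bessel_I:
  fixes \<nu> x :: real
  assumes x: "x > 0"
  shows "summable (\<lambda>m. rGamma (\<nu> + real m + 1) / fact m * (x / 2) powr (2 * real m + \<nu>))"
proof -
  define f where "f m = rGamma (\<nu> + real m + 1) / fact m * (x / 2) powr (2 * real m + \<nu>)" for m :: nat
  \<comment> \<open>Kept free of division: the factor \<nu> + m + 1 vanishes for one m when \<nu> is
    a negative integer.\<close>
  have rec: "real (Suc m) * (\<nu> + real m + 1) * f (Suc m) = (x / 2)\<^sup>2 * f m" for m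
  proof -
    have "rGamma (\<nu> + real m + 1) = (\<nu> + real m + 1) * rGamma (\<nu> + real (Suc m) + 1)"
      using rGamma_plus1[of "\<nu> + real m + 1", symmetric] by (simp add: add_ac)
    moreover have "(x/2) powr (2 * real (Suc m) + \<nu>) = (x/2) powr (2 * real m + \<nu>) * (x/2)\<^sup>2"
      using powr_add_nat[of "x/2" "2 * real m + \<nu>" 2] x by (simp add: algebra_simps)
    moreover have "real (Suc m) / fact (Suc m) = 1 / fact m"
      by (simp del: of_nat_Suc)
    moreover have "g * b * (c / f * d) = x * (a / h * e)"
      if "a = b * c" "d = e * x" "g / f = 1 / h" for a b c d e f g h x :: real
    proof -
      have "g * b * (c / f * d) = g / f * b * c * d" by simp
      then show ?thesis using that by simp
    qed
    ultimately show ?thesis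
      unfolding f_def by blast
  qed
  \<comment> \<open>Beyond this index the factor (m + 1)(\<nu> + m + 1) is at least x^2, so
    consecutive terms shrink by 1/4.\<close>
  obtain N0 :: nat where N0: "real N0 \<ge> x\<^sup>2 + \<bar>\<nu>\<bar> + 1"
    using real_arch_simple by blast
  have "norm (f (Suc m)) \<le> 1/2 * norm (f m)" if "m \<ge> N0" for m
  proof -
    have m: "real m \<ge> x\<^sup>2 + \<bar>\<nu>\<bar> + 1" using N0 that by linarith
    have pos: "\<nu> + real m + 1 \<ge> x\<^sup>2 + 1" using m by linarith
    have "real (Suc m) * (\<nu> + real m + 1) \<ge> 1 * (x\<^sup>2 + 1)"
      by (rule mult_mono) (use pos in auto)
    then have "real (Suc m) * (\<nu> + real m + 1) \<ge> x\<^sup>2" by simp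
    moreover have "real (Suc m) * (\<nu> + real m + 1) * \<bar>f (Suc m)\<bar> = (x / 2)\<^sup>2 * \<bar>f m\<bar>"
    proof -
      have "\<bar>real (Suc m) * (\<nu> + real m + 1)\<bar> = real (Suc m) * (\<nu> + real m + 1)"
        by (intro abs_of_nonneg mult_nonneg_nonneg) (use pos in \<open>auto intro: order_trans[OF _ pos]\<close>)
      then show ?thesis using arg_cong[OF rec[of m], of abs] by (simp only: abs_mult) simp
    qed
    ultimately have "x\<^sup>2 * \<bar>f (Suc m)\<bar> \<le> (x / 2)\<^sup>2 * \<bar>f m\<bar>"
      by (metis abs_ge_zero mult_right_mono)
    then have "x\<^sup>2 * \<bar>f (Suc m)\<bar> \<le> x\<^sup>2 * (1/4 * \<bar>f m\<bar>)"
      by (simp add: power_divide)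
    then have "\<bar>f (Suc m)\<bar> \<le> 1/4 * \<bar>f m\<bar>" using x by simp
    then show ?thesis by simp
  qed
  then have "summable f" by (intro summable_ratio_test[of "1/2" N0 f]) auto
  then show ?thesis by (simp add: f_def[abs_def])
qed

text \<open>Termwise: \<open>rGamma_plus1\<close> gives the series of order \<nu> - 1 the factor
  \<nu> + m, and the second series removes \<nu>. The remaining factor m kills the constant term and
  cancels against the factorial, so shifting the index by one produces the series of order \<nu> +
  1.\<close>

lemma bessel_I_recurrence:
  fixes \<nu> x :: real
  assumes x: "x > 0"
  shows "bessel_I (\<nu> + 1) x = bessel_I (\<nu> - 1) x - 2 * \<nu> / x * bessel_I \<nu> x"
proof -
  define f where "f \<mu> m = rGamma (\<mu> + real m + 1) / fact m * (x / 2) powr (2 * real m + \<mu>)"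
    for \<mu> and m :: nat
  have summ: "summable (f \<mu>)" for \<mu>
    using summable_bessel_I[OF x, of \<mu>] by (simp add: f_def[abs_def])
  have I: "bessel_I \<mu> x = suminf (f \<mu>)" for \<mu>
    by (simp add: bessel_I_def f_def[abs_def])
  define g where "g m = f (\<nu> - 1) m - 2 * \<nu> / x * f \<nu> m" for m
  have g: "g sums (bessel_I (\<nu> - 1) x - 2 * \<nu> / x * bessel_I \<nu> x)"
    unfolding g_def[abs_def] I by (intro sums_diff sums_mult summable_sums summ)
  have gm: "g m = real m * (rGamma (\<nu> + real m + 1) / fact m * (x / 2) powr (2 * real m + \<nu> - 1))" for m
  proof -
    have "rGamma (\<nu> + real m) = (\<nu> + real m) * rGamma (\<nu> + real m + 1)"
      by (rule rGamma_plus1[symmetric])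
    moreover have "(x/2) powr (2 * real m + \<nu>) = (x/2) powr (2 * real m + \<nu> - 1) * (x/2)"
      using powr_add_nat[of "x/2" "2 * real m + \<nu> - 1" 1] x by simp
    ultimately show ?thesis
      unfolding g_def f_def using x by (simp add: field_simps)
  qed
  have "g 0 = 0" using gm[of 0] by simp
  moreover have "g (Suc m) = f (\<nu> + 1) m" for m
  proof -
    have *: "2 * real (Suc m) + \<nu> - 1 = 2 * real m + (\<nu> + 1)" "\<nu> + real (Suc m) + 1 = \<nu> + 1 + real m + 1"
      by simp_all
    show ?thesis unfolding gm f_def * by (simp add: field_simps del: of_nat_Suc)
  qed
  ultimately have "f (\<nu> + 1) sums (bessel_I (\<nu> - 1) x - 2 * \<nu> / x * bessel_I \<nu> x)"
    using g sums_Suc_iff[of g "bessel_I (\<nu> - 1) x - 2 * \<nu> / x * bessel_I \<nu> x"] by simp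
  then show ?thesis using I[of "\<nu> + 1"] sums_unique by metis
qed

section \<open>The orders 1/2 and -1/2 as elementary functions\<close>

lemma rGamma_nat_plus_three_half:
  "rGamma (real m + 3/2) = 2 * rGamma (real m + 1/2) / (2 * real m + 1)"
proof -
  have "real m + 1/2 + 1 = real m + 3/2" "real m + 1/2 = (2 * real m + 1) / 2" by simp_all
  then have "(2 * real m + 1) / 2 * rGamma (real m + 3/2) = rGamma (real m + 1/2)"
    using rGamma_plus1[of "real m + 1/2"] by metis
  moreover have "2 * real m + 1 \<noteq> 0" by linarith
  ultimately show ?thesis
    by (subst eq_divide_eq) (simp only: if_True not_False_eq_True, simp add: mult_ac)
qed

text \<open>In the series of order -1/2 the factor m! cancels and (2 m)! remains, which is what
  turns it into the even series of cosh; one more factor 2 m + 1 gives sinh.\<close>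

lemma rGamma_nat_plus_half: "rGamma (real m + 1/2) = 4 ^ m * fact m / (fact (2 * m) * sqrt pi)"
proof (induction m)
  case 0
  have "rGamma (1/2 :: real) = 1 / sqrt pi"
    unfolding rGamma_inverse_Gamma Gamma_one_half_real by (rule inverse_eq_divide)
  then show ?case by simp
next
  case (Suc m)
  have f: "fact (2 * Suc m) = 2 * (real m + 1) * (2 * real m + 1) * fact (2 * m)"
    by (simp add: algebra_simps)
  have nz: "2 * real m + 1 \<noteq> 0" "real m + 1 \<noteq> 0" by linarith+
  have "real (Suc m) + 1/2 = real m + 3/2" by simp
  then have "rGamma (real (Suc m) + 1/2) = 2 * (4 ^ m * fact m / (fact (2 * m) * sqrt pi)) / (2 * real m + 1)"
    using rGamma_nat_plus_three_half Suc.IH by metis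
  also have "\<dots> = 4 ^ Suc m * ((real m + 1) * fact m) / (fact (2 * Suc m) * sqrt pi)"
    unfolding f using nz by (simp add: frac_eq_eq)
  finally show ?case by (simp add: add.commute)
qed

lemma bessel_I_minus_half:
  fixes x :: real
  assumes x: "x > 0"
  shows "bessel_I (- 1/2) x = sqrt (2 / (pi * x)) * cosh x"
proof -
  have "(\<lambda>m. sqrt (2 / (pi * x)) * (x ^ (2*m) / fact (2*m))) sums (sqrt (2 / (pi * x)) * cosh x)"
  proof (rule sums_mult)
    have "(\<lambda>n. if even n then x ^ n /\<^sub>R fact n else 0) sums cosh x" by (rule cosh_converges)
    moreover have "strict_mono (\<lambda>m::nat. 2 * m)" by (simp add: strict_mono_def)
    ultimately show "(\<lambda>m. x ^ (2*m) / fact (2*m)) sums cosh x"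
      using sums_mono_reindex[of "\<lambda>m::nat. 2*m" "\<lambda>n. if even n then x ^ n /\<^sub>R fact n else 0" "cosh x"]
      by (force simp: divide_inverse mult.commute image_iff elim!: evenE)
  qed
  moreover have "rGamma (- 1/2 + real m + 1) / fact m * (x / 2) powr (2 * real m + (- 1/2))
      = sqrt (2 / (pi * x)) * (x ^ (2*m) / fact (2*m))" for m
  proof -
    have "(x/2) powr (2 * real m + (- 1/2)) = (x/2) powr (-1/2) * (x/2) ^ (2*m)"
      using powr_add_nat[of "x/2" "-1/2" "2*m"] x by (simp add: algebra_simps)
    moreover have "(x/2) powr (-1/2) = sqrt (2/x)"
      using x powr_minus[of "x/2" "1/2"] by (simp add: powr_half_sqrt real_sqrt_divide)
    moreover have "rGamma (- 1/2 + real m + 1) = 4 ^ m * fact m / (fact (2 * m) * sqrt pi)"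
      using rGamma_nat_plus_half[of m] by (simp add: add_ac)
    ultimately have "rGamma (- 1/2 + real m + 1) / fact m * (x / 2) powr (2 * real m + (- 1/2))
      = 4 ^ m * fact m / (fact (2 * m) * sqrt pi) / fact m * (sqrt (2/x) * (x/2) ^ (2*m))"
      by (simp only:)
    then show ?thesis
      using x by (simp add: real_sqrt_divide real_sqrt_mult power_divide power_mult)
  qed
  ultimately show ?thesis unfolding bessel_I_def by (metis (no_types, lifting) ext sums_unique)
qed

lemma bessel_I_half:
  fixes x :: real
  assumes x: "x > 0"
  shows "bessel_I (1/2) x = sqrt (2 / (pi * x)) * sinh x"
proof -
  have "(\<lambda>m. sqrt (2 / (pi * x)) * (x ^ (2*m+1) / fact (2*m+1))) sums (sqrt (2 / (pi * x)) * sinh x)"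
  proof (rule sums_mult)
    have "(\<lambda>n. if even n then 0 else x ^ n /\<^sub>R fact n) sums sinh x" by (rule sinh_converges)
    moreover have "strict_mono (\<lambda>m::nat. 2 * m + 1)" by (simp add: strict_mono_def)
    ultimately show "(\<lambda>m. x ^ (2*m+1) / fact (2*m+1)) sums sinh x"
      using sums_mono_reindex[of "\<lambda>m::nat. 2*m+1" "\<lambda>n. if even n then 0 else x ^ n /\<^sub>R fact n" "sinh x"]
      by (force simp: divide_inverse mult.commute image_iff elim!: oddE)
  qed
  moreover have "rGamma (1/2 + real m + 1) / fact m * (x / 2) powr (2 * real m + 1/2)
      = sqrt (2 / (pi * x)) * (x ^ (2*m+1) / fact (2*m+1))" for m
  proof -
    have p: "(x/2) powr (2 * real m + 1/2) = (x/2) powr (-1/2) * (x/2) ^ (2*m+1)"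
      using powr_add_nat[of "x/2" "-1/2" "2*m+1"] x by (simp add: algebra_simps)
    have s: "(x/2) powr (-1/2) = sqrt (2/x)"
      using x powr_minus[of "x/2" "1/2"] by (simp add: powr_half_sqrt real_sqrt_divide)
    have "1/2 + real m + 1 = real m + 3/2" by simp
    then have r: "rGamma (1/2 + real m + 1) = 2 * (4 ^ m * fact m / (fact (2 * m) * sqrt pi)) / (2 * real m + 1)"
      using rGamma_nat_plus_three_half rGamma_nat_plus_half by metis
    have nz: "2 * real m + 1 \<noteq> 0" by linarith
    have f: "fact (2*m+1) = (2 * real m + 1) * fact (2*m)" by simp
    show ?thesis unfolding p s r f
      using x nz by (simp add: real_sqrt_divide real_sqrt_mult power_divide power_mult divide_simps)
  qed
  ultimately show ?thesis unfolding bessel_I_def by (metis (no_types, lifting) ext sums_unique)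
qed

text \<open>Coefficients of the classical Bessel polynomials, with the powers of 2 moved into the
  argument: \<open>bessel_poly k y\<close> is the k-th Bessel polynomial at 2 y. The value 0 beyond
  j = k keeps truncated subtraction out of the recurrence.\<close>

definition bessel_coeff :: "nat \<Rightarrow> nat \<Rightarrow> real" where
  "bessel_coeff k j = (if j \<le> k then fact (k + j) / (fact j * fact (k - j)) else 0)"

text \<open>For k = j + 1 + i the three fractions have a common denominator, and what remains is (i
  + 2j + 4)(i + 2j + 3) = (i + 2)(i + 1) + 2 (2k + 3)(j + 1). At j = k and j = k + 1 the first
  summand on the right is 0, and beyond that everything is.\<close>

lemma bessel_coeff_recurrence:
  "bessel_coeff (Suc (Suc k)) (Suc j) = bessel_coeff k (Suc j) + 2 * (2 * real k + 3) * bessel_coeff (Suc k) j"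
proof (cases "Suc j \<le> k")
  case True
  then obtain i where k: "k = Suc j + i" using le_Suc_ex by blast
  define a b c :: real where "a = fact (Suc j + i + Suc j)" and "b = fact j" and "c = fact i"
  have nz: "b > 0" "c > 0" by (simp_all add: b_def c_def)
  have 1: "bessel_coeff (Suc (Suc k)) (Suc j) = (real i + 2 * real j + 4) * (real i + 2 * real j + 3) * a
      / ((real j + 1) * b * ((real i + 2) * (real i + 1) * c))"
    by (simp add: bessel_coeff_def k a_def b_def c_def algebra_simps)
  have 2: "bessel_coeff k (Suc j) = a / ((real j + 1) * b * c)"
    by (simp add: bessel_coeff_def k a_def b_def c_def algebra_simps)
  have 3: "bessel_coeff (Suc k) j = a / (b * ((real i + 2) * (real i + 1) * c))"
    by (simp add: bessel_coeff_def k a_def b_def c_def algebra_simps)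
  have pos: "real j + 1 > 0" "real i + 2 > 0" "real i + 1 > 0" by linarith+
  define y1 y2 y3 where y: "y1 = real j + 1" "y2 = real i + 2" "y3 = real i + 1"
  have ypos: "y1 > 0" "y2 > 0" "y3 > 0" using pos y by simp_all
  have id: "(real i + 2 * real j + 4) * (real i + 2 * real j + 3) = y2 * y3 + 2 * (2 * real k + 3) * y1"
    unfolding y k by (simp add: algebra_simps)
  have A: "bessel_coeff k (Suc j) = y2 * y3 * a / (y1 * b * (y2 * y3 * c))"
    unfolding 2 y[symmetric] using ypos nz by (simp add: frac_eq_eq)
  have B: "bessel_coeff (Suc k) j = y1 * a / (y1 * b * (y2 * y3 * c))"
    unfolding 3 y[symmetric] using ypos nz by (simp add: frac_eq_eq)
  show ?thesis
    unfolding 1 A B id unfolding y[symmetric]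
    by (simp only: add_divide_distrib distrib_right mult.assoc times_divide_eq_right)
next
  case False
  show ?thesis
  proof (cases "j = k")
    case True
    have "bessel_coeff (Suc (Suc k)) (Suc k) = 2 * (2 * real k + 3) * bessel_coeff (Suc k) k"
    proof -
      have "(fact (Suc (Suc k) + Suc k) :: real) = 2 * (2 * real k + 3) * (real k + 1) * fact (Suc k + k)"
        by (simp add: algebra_simps)
      moreover have "(fact (Suc k) :: real) = (real k + 1) * fact k" by (simp add: algebra_simps)
      moreover have "real k + 1 \<noteq> 0" by linarith
      ultimately show ?thesis by (simp add: bessel_coeff_def del: fact_Suc)
    qed
    then show ?thesis using True by (simp add: bessel_coeff_def)
  next
    case jk: False
    show ?thesis
    proof (cases "j = Suc k")
      case True
      have "(fact (Suc (Suc k) + Suc (Suc k)) :: real) = 2 * (2 * real k + 3) * (real k + 2) * fact (Suc k + Suc k)"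
        by (simp add: algebra_simps)
      moreover have "(fact (Suc (Suc k)) :: real) = (real k + 2) * fact (Suc k)" by (simp add: algebra_simps)
      moreover have "real k + 2 \<noteq> 0" by linarith
      ultimately have "bessel_coeff (Suc (Suc k)) (Suc (Suc k)) = 2 * (2 * real k + 3) * bessel_coeff (Suc k) (Suc k)"
        by (simp add: bessel_coeff_def del: fact_Suc)
      then show ?thesis using True by (simp add: bessel_coeff_def)
    next
      case False
      then show ?thesis using jk \<open>\<not> Suc j \<le> k\<close> by (simp add: bessel_coeff_def)
    qed
  qed
qed

definition bessel_poly :: "nat \<Rightarrow> real \<Rightarrow> real" where
  "bessel_poly k y = (\<Sum>j\<le>k. bessel_coeff k j * y ^ j)"

lemma bessel_poly_recurrence:
  "bessel_poly (Suc (Suc k)) y = bessel_poly k y + 2 * (2 * real k + 3) * y * bessel_poly (Suc k) y"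
proof -
  have "bessel_poly k y = (\<Sum>j\<le>Suc (Suc k). bessel_coeff k j * y ^ j)"
    unfolding bessel_poly_def by (rule sum.mono_neutral_left) (auto simp: bessel_coeff_def)
  also have "\<dots> = bessel_coeff k 0 + (\<Sum>j\<le>Suc k. bessel_coeff k (Suc j) * y ^ Suc j)"
    by (subst sum.atMost_Suc_shift) simp
  finally have k: "bessel_poly k y = 1 + (\<Sum>j\<le>Suc k. bessel_coeff k (Suc j) * y ^ Suc j)"
    by (simp add: bessel_coeff_def)
  have "bessel_poly (Suc (Suc k)) y = bessel_coeff (Suc (Suc k)) 0
      + (\<Sum>j\<le>Suc k. bessel_coeff (Suc (Suc k)) (Suc j) * y ^ Suc j)"
    unfolding bessel_poly_def by (subst sum.atMost_Suc_shift) simp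
  also have "bessel_coeff (Suc (Suc k)) 0 = 1" by (simp add: bessel_coeff_def del: fact_Suc)
  also have "(\<Sum>j\<le>Suc k. bessel_coeff (Suc (Suc k)) (Suc j) * y ^ Suc j)
      = (\<Sum>j\<le>Suc k. bessel_coeff k (Suc j) * y ^ Suc j + 2 * (2 * real k + 3) * y * (bessel_coeff (Suc k) j * y ^ j))"
    by (intro sum.cong refl) (simp add: bessel_coeff_recurrence algebra_simps)
  also have "\<dots> = (\<Sum>j\<le>Suc k. bessel_coeff k (Suc j) * y ^ Suc j) + 2 * (2 * real k + 3) * y * bessel_poly (Suc k) y"
    unfolding bessel_poly_def by (simp only: sum.distrib sum_distrib_left)
  finally show ?thesis unfolding k by simp
qed

text \<open>The order is not an integer, so the quotient itself and not its limit applies, and the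
  sine in the denominator is 1 or -1.\<close>

lemma bessel_K_half_integer:
  "bessel_K (- real k - 1/2) x
     = pi / 2 * ((-1) ^ k * (bessel_I (- real k - 1/2) x - bessel_I (real k + 1/2) x))"
proof -
  have "- real k - 1/2 \<notin> \<int>"
  proof
    assume "- real k - 1/2 \<in> \<int>"
    then obtain z where "- real k - 1/2 = of_int z" by (elim Ints_cases)
    then have "real_of_int (- 2 * int k - 1) = real_of_int (2 * z)" by simp
    then have "- 2 * int k - 1 = 2 * z" by (rule of_int_eq_iff[THEN iffD1])
    then show False by presburger
  qed
  moreover have "sin ((- real k - 1/2) * pi) = - ((-1) ^ k)"
  proof -
    have "(- real k - 1/2) * pi = - (real k * pi + pi / 2)" by (simp add: algebra_simps)
    then have "sin ((- real k - 1/2) * pi) = - cos (real k * pi)"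
      by (simp only: sin_minus sin_add) simp
    then show ?thesis by simp
  qed
  moreover have "- (- real k - 1/2) = real k + 1/2" by simp
  moreover have "a / - ((-1) ^ k) = - ((-1) ^ k * a)" for a :: real
    by (cases "even k") auto
  ultimately show ?thesis unfolding bessel_K_def Let_def
    by (simp add: algebra_simps)
qed

text \<open>The functions I of orders k + 1/2 and -k - 1/2 obey the same recurrence in k, hence so
  does their difference; the alternating sign in \<open>bessel_K_half_integer\<close> turns its
  minus into a plus.\<close>

lemma bessel_K_recurrence:
  assumes x: "x > 0"
  shows "bessel_K (- real (Suc (Suc k)) - 1/2) x
     = bessel_K (- real k - 1/2) x + (2 * real k + 3) / x * bessel_K (- real (Suc k) - 1/2) x"
proof -
  have 1: "bessel_I (real (Suc (Suc k)) + 1/2) x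
      = bessel_I (real k + 1/2) x - (2 * real k + 3) / x * bessel_I (real (Suc k) + 1/2) x"
    using bessel_I_recurrence[OF x, of "real (Suc k) + 1/2"] by (simp add: algebra_simps)
  have 2: "bessel_I (- real (Suc (Suc k)) - 1/2) x
      = bessel_I (- real k - 1/2) x - (2 * real k + 3) / x * bessel_I (- real (Suc k) - 1/2) x"
  proof -
    have e: "- real (Suc k) - 1/2 + 1 = - real k - 1/2" "- real (Suc k) - 1/2 - 1 = - real (Suc (Suc k)) - 1/2"
      "2 * (- real (Suc k) - 1/2) / x = - ((2 * real k + 3) / x)"
      using x by (simp_all add: divide_simps)
    show ?thesis using bessel_I_recurrence[OF x, of "- real (Suc k) - 1/2"] unfolding e by simp
  qed
  define c where "c = (2 * real k + 3) / x"
  show ?thesis unfolding bessel_K_half_integer 1 2 c_def[symmetric]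
    by (simp add: algebra_simps del: of_nat_Suc)
qed

text \<open>Both sides satisfy the same two-step recurrence, so the orders -1/2 and -3/2 decide, and
  there cosh x - sinh x = exp (- x) yields the exponential.\<close>

lemma bessel_K_eq_bessel_poly:
  assumes x: "x > 0"
  shows "bessel_K (- real k - 1/2) x = sqrt (pi / (2 * x)) * exp (- x) * bessel_poly k (1 / (2 * x))"
proof -
  define A where "A = sqrt (pi / (2 * x)) * exp (- x)"
  have A: "pi / 2 * (sqrt (2 / (pi * x)) * cosh x - sqrt (2 / (pi * x)) * sinh x) = A"
  proof -
    have "pi / 2 * sqrt (2 / (pi * x)) = sqrt ((pi / 2)\<^sup>2 * (2 / (pi * x)))"
      by (simp only: real_sqrt_mult real_sqrt_abs) simp
    also have "(pi / 2)\<^sup>2 * (2 / (pi * x)) = pi / (2 * x)"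
      using x by (simp add: power2_eq_square)
    finally show ?thesis
      unfolding A_def using cosh_minus_sinh[of x] by (metis mult.assoc right_diff_distrib)
  qed
  have K0: "bessel_K (- real 0 - 1/2) x = A * bessel_poly 0 (1 / (2 * x))"
    using A bessel_K_half_integer[of 0 x] bessel_I_minus_half[OF x] bessel_I_half[OF x]
    by (simp add: bessel_poly_def bessel_coeff_def)
  have K1: "bessel_K (- real (Suc 0) - 1/2) x = A * bessel_poly (Suc 0) (1 / (2 * x))"
  proof -
    have a: "bessel_I (real (Suc 0) + 1/2) x = bessel_I (-1/2) x - 1 / x * bessel_I (1/2) x"
      using bessel_I_recurrence[OF x, of "1/2"] by (simp add: add.commute)
    have b: "bessel_I (- real (Suc 0) - 1/2) x = bessel_I (1/2) x - 1 / x * bessel_I (-1/2) x"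
      using bessel_I_recurrence[OF x, of "-1/2"] by simp
    have p: "bessel_poly (Suc 0) (1 / (2 * x)) = 1 + 1 / x"
      by (simp add: bessel_poly_def bessel_coeff_def)
    show ?thesis unfolding bessel_K_half_integer a b p A[symmetric]
        bessel_I_minus_half[OF x] bessel_I_half[OF x]
      by (simp add: algebra_simps)
  qed
  have "bessel_K (- real k - 1/2) x = A * bessel_poly k (1 / (2 * x)) \<and>
        bessel_K (- real (Suc k) - 1/2) x = A * bessel_poly (Suc k) (1 / (2 * x))"
  proof (induction k)
    case 0
    show ?case by (rule conjI[OF K0 K1])
  next
    case (Suc k)
    have "2 * (2 * real k + 3) * (1 / (2 * x)) = (2 * real k + 3) / x"
      using x by (simp add: frac_eq_eq)
    then have "bessel_poly (Suc (Suc k)) (1 / (2 * x))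
        = bessel_poly k (1 / (2 * x)) + (2 * real k + 3) / x * bessel_poly (Suc k) (1 / (2 * x))"
      using bessel_poly_recurrence[of k "1 / (2 * x)"] by (simp only:)
    then show ?case
      using Suc unfolding bessel_K_recurrence[OF x]
      by (simp only: distrib_left mult.left_commute)
  qed
  then show ?thesis by (simp add: A_def)
qed

text \<open>\<open>green_q \<gamma> k\<close> is the summand of the theorem without \<open>\<parallel>N\<parallel>\<^sup>k\<close>. In the splitting
  \<open>green_q \<gamma> (Suc k) = green_p \<gamma> k + green_r \<gamma> k\<close> the second part is \<open>1 / \<gamma>\<close> times the
  derivative of the left-hand side.\<close>

definition green_q :: "real \<Rightarrow> nat \<Rightarrow> real \<Rightarrow> real" where
  "green_q \<gamma> k \<tau> = (\<Sum>j\<le>k. fact (k + j) / (fact j * fact (k - j) * fact k) * \<tau> ^ (k - j) / \<gamma> ^ j)"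

definition green_p :: "real \<Rightarrow> nat \<Rightarrow> real \<Rightarrow> real" where
  "green_p \<gamma> k \<tau> = (\<Sum>j\<le>Suc k. fact (k + j) / (fact j * fact (Suc k - j) * fact k) * \<tau> ^ (Suc k - j) / \<gamma> ^ j)"

text \<open>For \<gamma> > 0 this is the integral of exp (- \<gamma> u)
  \<open>green_q \<gamma> k\<close> (\<tau> + u) over u > 0, that is, the polynomial solution of r'
  = \<gamma> r - q. It arises when the convolution is evaluated at a negative time.\<close>

definition green_r :: "real \<Rightarrow> nat \<Rightarrow> real \<Rightarrow> real" where
  "green_r \<gamma> k \<tau> = (\<Sum>j\<le>k. fact (Suc k + j) / (fact j * fact (k - j) * fact (Suc k)) * \<tau> ^ (k - j) / \<gamma> ^ Suc j)"

lemma green_q_bessel: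
  assumes "\<gamma> > 0" "\<tau> > 0"
  shows "\<tau> ^ k * sqrt (\<gamma> * \<tau>) * exp (\<gamma> * \<tau> / 2) * bessel_K (- real k - 1/2) (\<gamma> * \<tau> / 2) / (sqrt pi * fact k)
      = green_q \<gamma> k \<tau>"
proof -
  have 1: "sqrt (\<gamma> * \<tau>) * sqrt (pi / (\<gamma> * \<tau>)) = sqrt pi"
    using assms by (simp flip: real_sqrt_mult)
  have 2: "exp (\<gamma> * \<tau> / 2) * exp (- (\<gamma> * \<tau> / 2)) = 1" by (simp flip: exp_add)
  have 3: "bessel_K (- real k - 1/2) (\<gamma> * \<tau> / 2)
      = sqrt (pi / (\<gamma> * \<tau>)) * exp (- (\<gamma> * \<tau> / 2)) * bessel_poly k (1 / (\<gamma> * \<tau>))"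
    using bessel_K_eq_bessel_poly[of "\<gamma> * \<tau> / 2" k] assms by simp
  have "\<tau> ^ k * sqrt (\<gamma> * \<tau>) * exp (\<gamma> * \<tau> / 2) * bessel_K (- real k - 1/2) (\<gamma> * \<tau> / 2)
      = \<tau> ^ k * (sqrt (\<gamma> * \<tau>) * sqrt (pi / (\<gamma> * \<tau>)))
          * (exp (\<gamma> * \<tau> / 2) * exp (- (\<gamma> * \<tau> / 2))) * bessel_poly k (1 / (\<gamma> * \<tau>))"
    unfolding 3 by (simp only: mult_ac)
  also have "\<dots> = \<tau> ^ k * sqrt pi * bessel_poly k (1 / (\<gamma> * \<tau>))"
    unfolding 1 2 by simp
  finally have "\<tau> ^ k * sqrt (\<gamma> * \<tau>) * exp (\<gamma> * \<tau> / 2) * bessel_K (- real k - 1/2) (\<gamma> * \<tau> / 2)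
      = \<tau> ^ k * sqrt pi * bessel_poly k (1 / (\<gamma> * \<tau>))" .
  then have "\<tau> ^ k * sqrt (\<gamma> * \<tau>) * exp (\<gamma> * \<tau> / 2) * bessel_K (- real k - 1/2) (\<gamma> * \<tau> / 2) / (sqrt pi * fact k)
      = \<tau> ^ k * bessel_poly k (1 / (\<gamma> * \<tau>)) / fact k"
    by (simp only:) simp
  also have "\<dots> = green_q \<gamma> k \<tau>"
    unfolding bessel_poly_def green_q_def sum_distrib_left sum_divide_distrib
  proof (intro sum.cong refl)
    fix j assume "j \<in> {..k}"
    then have "\<tau> ^ k = \<tau> ^ (k - j) * \<tau> ^ j" by (simp flip: power_add)
    then show "\<tau> ^ k * (bessel_coeff k j * (1 / (\<gamma> * \<tau>)) ^ j) / fact k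
        = fact (k + j) / (fact j * fact (k - j) * fact k) * \<tau> ^ (k - j) / \<gamma> ^ j"
      using \<open>j \<in> {..k}\<close> assms by (simp add: bessel_coeff_def power_divide power_mult_distrib mult_ac)
  qed
  finally show ?thesis .
qed

text \<open>Up to a common factor the coefficient of index j on the left is k + 1 + j;
  \<open>green_p\<close> supplies k + 1 and \<open>green_r\<close>, with its index moved by one,
  supplies j.\<close>

lemma green_q_Suc:
  "green_q \<gamma> (Suc k) \<tau> = green_p \<gamma> k \<tau> + green_r \<gamma> k \<tau>"
proof -
  define f :: "nat \<Rightarrow> real" where "f j = (if j = 0 then 0 else fact (k + j) / (fact (j - 1) * fact (Suc k - j) * fact (Suc k)) * \<tau> ^ (Suc k - j) / \<gamma> ^ j)" for j
  have "green_r \<gamma> k \<tau> = (\<Sum>j\<le>k. f (Suc j))"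
    unfolding green_r_def f_def by (intro sum.cong refl) simp
  also have "\<dots> = (\<Sum>j\<le>Suc k. f j)"
    unfolding sum.atMost_Suc_shift[of f k] by (simp add: f_def)
  finally have "green_p \<gamma> k \<tau> + green_r \<gamma> k \<tau> = (\<Sum>j\<le>Suc k.
      fact (k + j) / (fact j * fact (Suc k - j) * fact k) * \<tau> ^ (Suc k - j) / \<gamma> ^ j + f j)"
    by (simp only: green_p_def sum.distrib)
  also have "\<dots> = green_q \<gamma> (Suc k) \<tau>"
    unfolding green_q_def
  proof (intro sum.cong refl)
    fix j assume j: "j \<in> {..Suc k}"
    define T where "T = \<tau> ^ (Suc k - j) / \<gamma> ^ j"
    define F :: real where "F = fact (Suc k - j)"
    have F: "F > 0" by (simp add: F_def)
    have fk: "(fact (Suc k) :: real) = (real k + 1) * fact k" by (simp add: algebra_simps)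
    have nz: "real k + 1 > 0" by linarith
    have "fact (k + j) / (fact j * F * fact k) + (if j = 0 then 0 else fact (k + j) / (fact (j - 1) * F * fact (Suc k)))
        = fact (Suc k + j) / (fact j * F * fact (Suc k))"
    proof (cases j)
      case 0
      then show ?thesis using F nz by (simp add: fk del: fact_Suc)
    next
      case (Suc i)
      have fj: "(fact j :: real) = real j * fact i" using Suc by simp
      have j0: "real j > 0" using Suc by simp
      have fs: "(fact (Suc k + j) :: real) = (real k + 1 + real j) * fact (k + j)" by (simp add: algebra_simps)
      have "fact (k + j) / (real j * fact i * F * fact k) = (real k + 1) * fact (k + j) / (real j * fact i * F * ((real k + 1) * fact k))"
        using nz j0 F by (simp add: frac_eq_eq)
      moreover have "fact (k + j) / (fact i * F * ((real k + 1) * fact k)) = real j * fact (k + j) / (real j * fact i * F * ((real k + 1) * fact k))"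
        using nz j0 F by (simp add: frac_eq_eq)
      ultimately show ?thesis unfolding fs fj fk using Suc
        by (simp only: distrib_right add_divide_distrib if_False nat.distinct) (simp add: mult_ac)
    qed
    then have "(fact (k + j) / (fact j * F * fact k) + (if j = 0 then 0 else fact (k + j) / (fact (j - 1) * F * fact (Suc k)))) * T
        = fact (Suc k + j) / (fact j * F * fact (Suc k)) * T" by (rule arg_cong)
    moreover have "f j = (if j = 0 then 0 else fact (k + j) / (fact (j - 1) * F * fact (Suc k))) * T"
      by (simp add: f_def T_def F_def del: fact_Suc)
    ultimately show "fact (k + j) / (fact j * fact (Suc k - j) * fact k) * \<tau> ^ (Suc k - j) / \<gamma> ^ j + f j
        = fact (Suc k + j) / (fact j * fact (Suc k - j) * fact (Suc k)) * \<tau> ^ (Suc k - j) / \<gamma> ^ j"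
      by (simp only: distrib_right T_def F_def times_divide_eq_right[symmetric])
  qed
  finally show ?thesis by simp
qed

lemma has_real_derivative_green_p:
  "(green_p \<gamma> k has_real_derivative green_q \<gamma> k \<tau>) (at \<tau> within S)"
proof -
  have "(green_p \<gamma> k has_real_derivative
     (\<Sum>j\<le>Suc k. fact (k + j) / (fact j * fact (Suc k - j) * fact k) * (real (Suc k - j) * \<tau> ^ (Suc k - j - 1)) / \<gamma> ^ j)) (at \<tau> within S)"
    unfolding green_p_def[abs_def] by (intro DERIV_sum DERIV_cdivide DERIV_cmult) (auto intro!: derivative_eq_intros)
  also have "(\<Sum>j\<le>Suc k. fact (k + j) / (fact j * fact (Suc k - j) * fact k) * (real (Suc k - j) * \<tau> ^ (Suc k - j - 1)) / \<gamma> ^ j)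
     = green_q \<gamma> k \<tau>"
  proof -
    have "fact (k + j) / (fact j * fact (Suc k - j) * fact k) * (real (Suc k - j) * \<tau> ^ (Suc k - j - 1)) / \<gamma> ^ j
      = fact (k + j) / (fact j * fact (k - j) * fact k) * \<tau> ^ (k - j) / \<gamma> ^ j" if "j \<le> k" for j
    proof -
      have e: "Suc k - j = Suc (k - j)" using that by simp
      have "(fact (Suc k - j) :: real) = real (Suc k - j) * fact (k - j)" unfolding e by simp
      moreover have "real (Suc k - j) \<noteq> 0" "Suc k - j - 1 = k - j" using that by auto
      ultimately show ?thesis by (simp del: of_nat_Suc fact_Suc)
    qed
    then show ?thesis unfolding green_q_def by simp
  qed
  finally show ?thesis .
qed

lemma has_real_derivative_green_q_Suc:
  assumes "\<gamma> \<noteq> 0"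
  shows "(green_q \<gamma> (Suc k) has_real_derivative \<gamma> * green_r \<gamma> k \<tau>) (at \<tau> within S)"
proof -
  have "(green_q \<gamma> (Suc k) has_real_derivative
     (\<Sum>j\<le>Suc k. fact (Suc k + j) / (fact j * fact (Suc k - j) * fact (Suc k)) * (real (Suc k - j) * \<tau> ^ (Suc k - j - 1)) / \<gamma> ^ j)) (at \<tau> within S)"
    unfolding green_q_def[abs_def] by (intro DERIV_sum DERIV_cdivide DERIV_cmult) (auto intro!: derivative_eq_intros simp del: fact_Suc)
  also have "(\<Sum>j\<le>Suc k. fact (Suc k + j) / (fact j * fact (Suc k - j) * fact (Suc k)) * (real (Suc k - j) * \<tau> ^ (Suc k - j - 1)) / \<gamma> ^ j)
     = \<gamma> * green_r \<gamma> k \<tau>"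
  proof -
    have "fact (Suc k + j) / (fact j * fact (Suc k - j) * fact (Suc k)) * (real (Suc k - j) * \<tau> ^ (Suc k - j - 1)) / \<gamma> ^ j
      = \<gamma> * (fact (Suc k + j) / (fact j * fact (k - j) * fact (Suc k)) * \<tau> ^ (k - j) / \<gamma> ^ Suc j)" if "j \<le> k" for j
    proof -
      have e: "Suc k - j = Suc (k - j)" using that by simp
      have "(fact (Suc k - j) :: real) = real (Suc k - j) * fact (k - j)" unfolding e by simp
      moreover have "real (Suc k - j) \<noteq> 0" "Suc k - j - 1 = k - j" using that by auto
      ultimately show ?thesis using assms by (simp del: of_nat_Suc fact_Suc)
    qed
    then show ?thesis unfolding green_r_def by (simp add: sum_distrib_left del: fact_Suc)
  qed
  finally show ?thesis .
qed

text \<open>Subtract the derivative of \<open>green_p\<close> from that of \<open>green_q\<close> of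
  the next index. With \<gamma> = \<alpha> + \<beta> this equation turns the growth rate \<beta> of
  \<open>green_a\<close> at negative times into the rate - \<alpha> of its differential
  equation.\<close>

lemma has_real_derivative_green_r:
  assumes "\<gamma> \<noteq> 0"
  shows "(green_r \<gamma> k has_real_derivative \<gamma> * green_r \<gamma> k \<tau> - green_q \<gamma> k \<tau>) (at \<tau> within S)"
proof -
  have "green_r \<gamma> k = (\<lambda>\<tau>. green_q \<gamma> (Suc k) \<tau> - green_p \<gamma> k \<tau>)" by (simp add: green_q_Suc fun_eq_iff)
  then have "(green_r \<gamma> k has_real_derivative D) (at \<tau> within S) \<longleftrightarrow>
    ((\<lambda>\<tau>. green_q \<gamma> (Suc k) \<tau> - green_p \<gamma> k \<tau>) has_real_derivative D) (at \<tau> within S)" for D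
    by (rule arg_cong)
  then show ?thesis
    using DERIV_diff[OF has_real_derivative_green_q_Suc[OF assms] has_real_derivative_green_p] by blast
qed

text \<open>Continuity of the convolution at time 0: among the antiderivatives of
  \<open>green_q\<close>, \<open>green_p\<close> is the one that matches the mass collected at
  negative times.\<close>

lemma green_p_0: "green_p \<gamma> k 0 = green_r \<gamma> k 0"
proof -
  have "green_p \<gamma> k 0 = fact (Suc (k + k)) / (fact (Suc k) * fact k) / \<gamma> ^ Suc k"
  proof -
    have "green_p \<gamma> k 0 = (\<Sum>j\<in>{Suc k}. fact (k + j) / (fact j * fact (Suc k - j) * fact k) * 0 ^ (Suc k - j) / \<gamma> ^ j)"
      unfolding green_p_def by (rule sum.mono_neutral_right) auto
    then show ?thesis by simp
  qed
  moreover have "green_r \<gamma> k 0 = fact (Suc (k + k)) / (fact k * fact (Suc k)) / \<gamma> ^ Suc k"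
  proof -
    have "green_r \<gamma> k 0 = (\<Sum>j\<in>{k}. fact (Suc k + j) / (fact j * fact (k - j) * fact (Suc k)) * 0 ^ (k - j) / \<gamma> ^ Suc j)"
      unfolding green_r_def by (rule sum.mono_neutral_right) auto
    then show ?thesis by simp
  qed
  ultimately show ?thesis by (simp only: mult.commute)
qed

section \<open>Convolution powers of the two-sided exponential\<close>

text \<open>\<open>green_h\<close> is the \<open>(k+1)\<close>-fold convolution power of the two-sided exponential, and
  \<open>green_a\<close> the convolution of \<open>green_h\<close> with its right half.\<close>

definition green_h :: "real \<Rightarrow> real \<Rightarrow> nat \<Rightarrow> real \<Rightarrow> real" where
  "green_h \<alpha> \<beta> k t = (if 0 < t then exp (- \<alpha> * t) * green_q (\<alpha> + \<beta>) k t else exp (\<beta> * t) * green_q (\<alpha> + \<beta>) k (- t))"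

definition green_a :: "real \<Rightarrow> real \<Rightarrow> nat \<Rightarrow> real \<Rightarrow> real" where
  "green_a \<alpha> \<beta> k t = (if 0 \<le> t then exp (- \<alpha> * t) * green_p (\<alpha> + \<beta>) k t else exp (\<beta> * t) * green_r (\<alpha> + \<beta>) k (- t))"

lemma green_h_reflect: "t \<noteq> 0 \<Longrightarrow> green_h \<alpha> \<beta> k (- t) = green_h \<beta> \<alpha> k t"
  by (auto simp: green_h_def add.commute)

lemma green_h_Suc:
  "t \<noteq> 0 \<Longrightarrow> green_h \<alpha> \<beta> (Suc k) t = green_a \<alpha> \<beta> k t + green_a \<beta> \<alpha> k (- t)"
  by (auto simp: green_h_def green_a_def green_q_Suc algebra_simps)

text \<open>The same linear equation holds on both sides of 0, although the two formulas carry
  different exponentials; this makes \<open>green_a\<close> the scalar majorant of the stable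
  coordinates.\<close>

lemma has_real_derivative_green_a:
  assumes "t \<noteq> 0" "\<alpha> + \<beta> \<noteq> 0"
  shows "(green_a \<alpha> \<beta> k has_real_derivative - \<alpha> * green_a \<alpha> \<beta> k t + green_h \<alpha> \<beta> k t) (at t)"
proof (cases "t > 0")
  case True
  have "((\<lambda>t. exp (- \<alpha> * t) * green_p (\<alpha> + \<beta>) k t) has_real_derivative - \<alpha> * green_a \<alpha> \<beta> k t + green_h \<alpha> \<beta> k t) (at t)"
    using True by (auto intro!: derivative_eq_intros has_real_derivative_green_p simp: green_a_def green_h_def)
  moreover have "eventually (\<lambda>s. exp (- \<alpha> * s) * green_p (\<alpha> + \<beta>) k s = green_a \<alpha> \<beta> k s) (nhds t)"
    by (rule eventually_mono[OF eventually_nhds_in_open[of "{0<..}"]])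
       (use True in \<open>auto simp: green_a_def\<close>)
  ultimately show ?thesis by (subst (asm) DERIV_cong_ev) auto
next
  case False
  then have t: "t < 0" using assms by simp
  have "((\<lambda>t. exp (\<beta> * t) * green_r (\<alpha> + \<beta>) k (- t)) has_real_derivative - \<alpha> * green_a \<alpha> \<beta> k t + green_h \<alpha> \<beta> k t) (at t)"
    using t by (auto intro!: derivative_eq_intros DERIV_chain2[OF has_real_derivative_green_r[OF assms(2)]]
       simp: green_a_def green_h_def algebra_simps)
  moreover have "eventually (\<lambda>s. exp (\<beta> * s) * green_r (\<alpha> + \<beta>) k (- s) = green_a \<alpha> \<beta> k s) (nhds t)"
    by (rule eventually_mono[OF eventually_nhds_in_open[of "{..<0}"]])
       (use t in \<open>auto simp: green_a_def\<close>)
  ultimately show ?thesis by (subst (asm) DERIV_cong_ev) auto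
qed

lemma continuous_green_a:
  assumes "\<alpha> + \<beta> \<noteq> 0"
  shows "continuous_on UNIV (green_a \<alpha> \<beta> k)"
proof -
  have c: "continuous_on UNIV (green_p (\<alpha> + \<beta>) k)" "continuous_on UNIV (green_r (\<alpha> + \<beta>) k)"
    by (rule DERIV_continuous_on, rule has_real_derivative_green_p has_real_derivative_green_r[OF assms])+
  have "continuous_on ({0..} \<union> {..0}) (\<lambda>t. if 0 \<le> t then exp (- \<alpha> * t) * green_p (\<alpha> + \<beta>) k t else exp (\<beta> * t) * green_r (\<alpha> + \<beta>) k (- t))"
    by (rule continuous_on_If)
      (auto intro!: continuous_intros continuous_on_compose2[OF c(1)] continuous_on_compose2[OF c(2)] simp: green_p_0)
  moreover have "{0..} \<union> {..0} = (UNIV :: real set)" by auto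
  ultimately show ?thesis by (simp add: green_a_def[abs_def])
qed

section \<open>Decay at infinity and comparison from minus infinity\<close>

lemma tendsto_exp_mult_power_at_bot:
  fixes c :: real assumes "c > 0"
  shows "((\<lambda>t. exp (c * t) * (- t) ^ n) \<longlongrightarrow> 0) at_bot"
proof -
  have "((\<lambda>s. (c * s) ^ n / exp (c * s) / c ^ n) \<longlongrightarrow> 0 / c ^ n) at_top"
    using assms by (intro tendsto_divide tendsto_const filterlim_compose[OF tendsto_power_div_exp_0]
       filterlim_tendsto_pos_mult_at_top[OF tendsto_const] filterlim_ident) auto
  moreover have "(c * s) ^ n / exp (c * s) / c ^ n = exp (c * (- s)) * (- (- s)) ^ n" for s
    using assms by (simp add: power_mult_distrib exp_minus field_simps)
  ultimately show ?thesis unfolding filterlim_at_bot_mirror by simp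
qed

lemma green_a_at_bot:
  assumes "\<beta> > 0"
  shows "(green_a \<alpha> \<beta> k \<longlongrightarrow> 0) at_bot"
proof -
  have "((\<lambda>t. \<Sum>j\<le>k. fact (Suc k + j) / (fact j * fact (k - j) * fact (Suc k)) * (exp (\<beta> * t) * (- t) ^ (k - j)) / (\<alpha> + \<beta>) ^ Suc j) \<longlongrightarrow>
     (\<Sum>j\<le>k. fact (Suc k + j) / (fact j * fact (k - j) * fact (Suc k)) * 0 * inverse ((\<alpha> + \<beta>) ^ Suc j))) at_bot"
    unfolding divide_inverse by (intro tendsto_intros tendsto_exp_mult_power_at_bot assms)
  moreover have "eventually (\<lambda>t. (\<Sum>j\<le>k. fact (Suc k + j) / (fact j * fact (k - j) * fact (Suc k)) * (exp (\<beta> * t) * (- t) ^ (k - j)) / (\<alpha> + \<beta>) ^ Suc j)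
      = green_a \<alpha> \<beta> k t) at_bot"
    using eventually_gt_at_bot[of 0]
    by eventually_elim (simp add: green_a_def green_r_def sum_distrib_left mult_ac)
  ultimately show ?thesis by (simp add: filterlim_cong)
qed

text \<open>Up to t the function decreases, so its value at t is below its limit at minus infinity.
  No derivative is assumed at 0, the place where the Green terms jump; continuity carries the
  monotonicity across.\<close>

lemma nonpos_if_tendsto_0_at_bot:
  fixes f f' :: "real \<Rightarrow> real"
  assumes cont: "continuous_on UNIV f"
    and der: "\<And>s. s < t \<Longrightarrow> s \<noteq> 0 \<Longrightarrow> (f has_real_derivative f' s) (at s)"
    and le: "\<And>s. s < t \<Longrightarrow> s \<noteq> 0 \<Longrightarrow> f' s \<le> 0"
    and lim: "(f \<longlongrightarrow> 0) at_bot"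
  shows "f t \<le> 0"
proof -
  have mono: "f v \<le> f u" if "u \<le> v" "v \<le> t" "0 \<notin> {u<..<v}" for u v
  proof (rule DERIV_nonpos_imp_decreasing_open[OF \<open>u \<le> v\<close>])
    fix x assume "u < x" "x < v"
    with that have "x < t" "x \<noteq> 0" by auto
    then show "\<exists>y. (f has_real_derivative y) (at x) \<and> y \<le> 0" using der le by blast
  qed (use cont continuous_on_subset in blast)
  have "f t \<le> f u" if "u \<le> t" for u
  proof (cases "u < 0 \<and> 0 < t")
    case True
    then have "f t \<le> f 0" "f 0 \<le> f u" by (auto intro: mono)
    then show ?thesis by simp
  next
    case False
    then show ?thesis using that by (intro mono) auto
  qed
  then have "eventually (\<lambda>u. f t \<le> f u) at_bot"
    by (rule eventually_mono[OF eventually_le_at_bot[of t]])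
  then show ?thesis using lim tendsto_lowerbound by (metis trivial_limit_at_bot_linorder)
qed

text \<open>Finite-dimensional Hahn-Banach: a hyperplane separates \<open>y\<close> from the convex
  set where the norm is below that of \<open>y\<close>, and its normal is rescaled. A real
  functional suffices, since only the real number \<open>\<nu> y\<close> has to be
  recovered.\<close>

lemma vector_norm_functional:
  fixes \<nu> :: "complex ^ 'n \<Rightarrow> real"
  assumes "vector_norm \<nu>"
  obtains a where "inner a y = \<nu> y" and "\<And>v. inner a v \<le> \<nu> v"
proof (cases "y = 0")
  case True
  have "inner 0 y = \<nu> y" "inner 0 v \<le> \<nu> v" for v
    using assms True by (auto simp: vector_norm_def)
  then show ?thesis using that[of 0] by blast
next
  case False
  have nn: "0 \<le> \<nu> v" and nz: "\<nu> v = 0 \<longleftrightarrow> v = 0" and tri: "\<nu> (v + w) \<le> \<nu> v + \<nu> w" for v w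
    using assms by (auto simp: vector_norm_def)
  have "c *\<^sub>R v = complex_of_real c *s v" for c and v :: "complex ^ 'n"
    by (simp add: vec_eq_iff scaleR_conv_of_real[where 'a = complex])
  then have hom: "\<nu> (c *\<^sub>R v) = \<bar>c\<bar> * \<nu> v" for c v
    using assms by (simp add: vector_norm_def)
  define S where "S = {v. \<nu> v < \<nu> y}"
  have ypos: "\<nu> y > 0" using nn[of y] nz[of y] False by linarith
  have "convex S"
  proof (rule convexI)
    fix v w and p q :: real
    assume *: "v \<in> S" "w \<in> S" "0 \<le> p" "0 \<le> q" "p + q = 1"
    have "\<nu> (p *\<^sub>R v + q *\<^sub>R w) \<le> p * \<nu> v + q * \<nu> w"
      using tri[of "p *\<^sub>R v" "q *\<^sub>R w"] * by (simp add: hom)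
    also have "\<dots> < \<nu> y" using * convex_bound_lt[of "\<nu> v" "\<nu> y" "\<nu> w" p q] by (simp add: S_def)
    finally show "p *\<^sub>R v + q *\<^sub>R w \<in> S" by (simp add: S_def)
  qed
  moreover have "0 \<in> S" using ypos nz[of 0] by (simp add: S_def)
  moreover have "S \<inter> {y} = {}" by (simp add: S_def)
  ultimately obtain a b where a: "a \<noteq> 0" and S: "\<forall>v\<in>S. inner a v \<le> b" and b: "b \<le> inner a y"
    using separating_hyperplane_sets[of S "{y}"] by auto
  have bound: "inner a v * \<nu> y \<le> inner a y * \<nu> v" for v
  proof -
    \<comment> \<open>\<open>S\<close> has strict inequality, so \<open>v\<close> is scaled into it
      with \<open>c\<close> strictly above its norm; \<open>c\<close> then tends to that
      norm.\<close>
    have "inner a v * \<nu> y \<le> inner a y * c" if "c > \<nu> v" for c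
    proof -
      have c: "c > 0" using nn[of v] that by simp
      have "\<nu> v * \<nu> y < c * \<nu> y" using ypos that by simp
      then have "(\<nu> y / c) *\<^sub>R v \<in> S"
        using c ypos by (simp add: S_def hom pos_divide_less_eq mult.commute)
      then have "\<nu> y / c * inner a v \<le> inner a y" using S b by fastforce
      then show ?thesis using c by (simp add: pos_divide_le_eq mult.commute)
    qed
    then have "eventually (\<lambda>c. inner a v * \<nu> y \<le> inner a y * c) (at_right (\<nu> v))"
      by (auto simp: eventually_at_right_field intro!: exI[of _ "\<nu> v + 1"])
    moreover have "((\<lambda>c. inner a y * c) \<longlongrightarrow> inner a y * \<nu> v) (at_right (\<nu> v))"
      by (intro tendsto_intros)
    ultimately show ?thesis using tendsto_lowerbound trivial_limit_at_right_real by blast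
  qed
  have "0 < inner a y"
  proof -
    \<comment> \<open>Testing the bound on \<open>a\<close> itself fixes the sign needed for the
      rescaling.\<close>
    have "0 < inner a a * \<nu> y" using a ypos by simp
    also have "\<dots> \<le> inner a y * \<nu> a" by (rule bound)
    finally show ?thesis using nn[of a] by (simp add: zero_less_mult_iff)
  qed
  define k where "k = \<nu> y / inner a y"
  have "inner (k *\<^sub>R a) y = \<nu> y" using \<open>0 < inner a y\<close> by (simp add: k_def)
  moreover have "inner (k *\<^sub>R a) v \<le> \<nu> v" for v
    using bound[of v] \<open>0 < inner a y\<close> by (simp add: k_def pos_divide_le_eq mult.commute)
  ultimately show ?thesis using that by blast
qed

text \<open>Variation of constants without integrals: the derivative of the difference of the two
  antiderivatives has a sign.\<close>

lemma stable_part_bound: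
  fixes \<nu> :: "complex ^ 'n \<Rightarrow> real" and y w :: "real \<Rightarrow> complex ^ 'n" and d :: "'n \<Rightarrow> complex"
    and a h :: "real \<Rightarrow> real"
  assumes diag: "\<And>e v C. (\<And>i. cmod (e i) \<le> C) \<Longrightarrow> \<nu> (\<chi> i. e i * v $ i) \<le> C * \<nu> v"
    and c: "\<And>v. inner c v \<le> \<nu> v"
    and gap: "\<And>i. Re (d i) < 0 \<Longrightarrow> Re (d i) \<le> - \<alpha>"
    and y_der: "\<And>i s. s \<noteq> 0 \<Longrightarrow> ((\<lambda>s. y s $ i) has_vector_derivative d i * y s $ i + w s $ i) (at s)"
    and y_cont: "\<And>i. continuous_on UNIV (\<lambda>s. y s $ i)"
    and y_lim: "\<And>i. ((\<lambda>s. y s $ i) \<longlongrightarrow> 0) at_bot"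
    and w: "\<And>s. s \<noteq> 0 \<Longrightarrow> \<nu> (w s) \<le> M * h s"
    and \<alpha>: "\<alpha> > 0"
    and a_der: "\<And>s. s \<noteq> 0 \<Longrightarrow> (a has_real_derivative - \<alpha> * a s + h s) (at s)"
    and a_cont: "continuous_on UNIV a"
    and a_lim: "(a \<longlongrightarrow> 0) at_bot"
  shows "inner c (\<chi> i. if Re (d i) < 0 then y t $ i else 0) \<le> M * a t"
proof -
  \<comment> \<open>The diagonal propagator from time \<open>s\<close> to time \<open>t\<close>, set
    to 0 on the unstable coordinates; \<open>u\<close> is its scalar majorant for s before
    t.\<close>
  define E where "E i s = (if Re (d i) < 0 then exp (d i * of_real (t - s)) else 0)" for i s
  define u where "u s = exp (- \<alpha> * (t - s))" for s
  \<comment> \<open>At s = t this is the difference to be bounded. The homogeneous terms cancel in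
    its derivative, leaving the propagated source minus its majorant.\<close>
  define f where "f s = (\<Sum>i\<in>UNIV. inner (c $ i) (E i s * y s $ i)) - M * (u s * a s)" for s
  define f' where "f' s = (\<Sum>i\<in>UNIV. inner (c $ i) (E i s * w s $ i)) - M * (u s * h s)" for s
  have E_le: "cmod (E i s) \<le> u s" if "s \<le> t" for i s
    using mult_right_mono[OF gap[of i], of "t - s"] that by (auto simp: E_def u_def)
  have E_der: "((\<lambda>s. E i s) has_vector_derivative - d i * E i s) (at s)" for i s
  proof (cases "Re (d i) < 0")
    case True
    have "((\<lambda>s. exp (d i * of_real (t - s))) has_vector_derivative - d i * exp (d i * of_real (t - s))) (at s)"
    proof -
      have "((\<lambda>z. exp (d i * (of_real t - z))) has_field_derivative - d i * exp (d i * (of_real t - of_real s))) (at (of_real s))"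
        by (auto intro!: derivative_eq_intros)
      then show ?thesis using has_vector_derivative_real_field by fastforce
    qed
    then show ?thesis using True by (simp add: E_def[abs_def])
  qed (simp add: E_def[abs_def])
  have u_der: "(u has_real_derivative \<alpha> * u s) (at s)" for s
    unfolding u_def[abs_def] by (auto intro!: derivative_eq_intros)
  have "f t \<le> 0"
  proof (rule nonpos_if_tendsto_0_at_bot[where f = f and f' = f' and t = t])
    have "continuous_on UNIV (E i)" for i
      by (intro differentiable_imp_continuous_on)
        (meson E_der differentiable_on_def differentiableI_vector has_vector_derivative_at_within)
    moreover have "continuous_on UNIV u" by (rule DERIV_continuous_on, rule u_der)
    ultimately show "continuous_on UNIV f"
      unfolding f_def by (intro continuous_intros a_cont y_cont)
  next
    fix s :: real assume "s < t" "s \<noteq> 0"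
    have "((\<lambda>s. inner (c $ i) (E i s * y s $ i)) has_vector_derivative inner (c $ i) (E i s * w s $ i)) (at s)" for i
    proof -
      have "((\<lambda>s. E i s * y s $ i) has_vector_derivative E i s * (d i * y s $ i + w s $ i) + - d i * E i s * y s $ i) (at s)"
        by (intro has_vector_derivative_mult E_der y_der \<open>s \<noteq> 0\<close>)
      then have "((\<lambda>s. E i s * y s $ i) has_vector_derivative E i s * w s $ i) (at s)"
        by (simp add: algebra_simps)
      then show ?thesis by (rule bounded_linear.has_vector_derivative[OF bounded_linear_inner_right])
    qed
    then have "((\<lambda>s. \<Sum>i\<in>UNIV. inner (c $ i) (E i s * y s $ i)) has_vector_derivative (\<Sum>i\<in>UNIV. inner (c $ i) (E i s * w s $ i))) (at s)"
      by (intro has_vector_derivative_sum)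
    moreover have "((\<lambda>s. M * (u s * a s)) has_real_derivative M * (u s * h s)) (at s)"
      by (rule derivative_eq_intros u_der a_der[OF \<open>s \<noteq> 0\<close>] refl)+ (simp add: algebra_simps)
    ultimately show "(f has_real_derivative f' s) (at s)"
      unfolding f_def f'_def has_real_derivative_iff_has_vector_derivative
      by (intro has_vector_derivative_diff)
  next
    fix s :: real assume s: "s < t" "s \<noteq> 0"
    have "(\<Sum>i\<in>UNIV. inner (c $ i) (E i s * w s $ i)) = inner c (\<chi> i. E i s * w s $ i)"
      by (simp add: inner_vec_def)
    also have "\<dots> \<le> \<nu> (\<chi> i. E i s * w s $ i)" by (rule c)
    also have "\<dots> \<le> u s * \<nu> (w s)" by (rule diag) (use s E_le in auto)
    also have "\<dots> \<le> u s * (M * h s)" using w[OF s(2)] by (simp add: u_def)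
    finally show "f' s \<le> 0" by (simp add: f'_def mult_ac)
  next
    \<comment> \<open>Before time t both propagators are at most 1 in modulus, so the limits of
      \<open>y\<close> and \<open>a\<close> alone give the limit 0.\<close>
    have "((\<lambda>s. inner (c $ i) (E i s * y s $ i)) \<longlongrightarrow> inner (c $ i) 0) at_bot" for i
    proof (intro tendsto_inner tendsto_const Lim_null_comparison[OF _ tendsto_norm_zero[OF y_lim]])
      show "\<forall>\<^sub>F s in at_bot. cmod (E i s * y s $ i) \<le> cmod (y s $ i)"
      proof (rule eventually_mono[OF eventually_le_at_bot[of t]])
        fix s assume "s \<le> t"
        then have "cmod (E i s) \<le> u s" "u s \<le> 1" using E_le \<alpha> by (auto simp: u_def)
        then show "cmod (E i s * y s $ i) \<le> cmod (y s $ i)"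
          using mult_right_mono[of "cmod (E i s)" 1 "cmod (y s $ i)"] by (simp add: norm_mult)
      qed
    qed
    moreover have "((\<lambda>s. u s * a s) \<longlongrightarrow> 0) at_bot"
    proof (rule Lim_null_comparison[OF _ tendsto_norm_zero[OF a_lim]])
      show "\<forall>\<^sub>F s in at_bot. norm (u s * a s) \<le> norm (a s)"
        by (rule eventually_mono[OF eventually_le_at_bot[of t]])
          (use \<alpha> in \<open>auto simp: u_def abs_mult intro!: mult_left_le_one_le\<close>)
    qed
    ultimately have "(f \<longlongrightarrow> (\<Sum>i\<in>UNIV. inner (c $ i) 0) - M * 0) at_bot"
      unfolding f_def by (intro tendsto_diff tendsto_sum tendsto_mult_left)
    then show "(f \<longlongrightarrow> 0) at_bot" by simp
  qed
  moreover have "(\<Sum>i\<in>UNIV. inner (c $ i) (E i t * y t $ i)) = inner c (\<chi> i. if Re (d i) < 0 then y t $ i else 0)"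
    unfolding inner_vec_def by (intro sum.cong refl) (simp add: E_def)
  ultimately show ?thesis by (simp add: f_def u_def)
qed

text \<open>Reflecting time makes unstable coordinates stable: y (- s) solves the system with - d
  and - w, and \<alpha> and \<beta> change places. One functional attaining the norm of
  \<open>y t\<close> tests both halves, so their bounds add up, by \<open>green_h_Suc\<close>, to
  exactly the next convolution power.\<close>

lemma dichotomy_bound:
  fixes \<nu> :: "complex ^ 'n \<Rightarrow> real" and y w :: "real \<Rightarrow> complex ^ 'n" and d :: "'n \<Rightarrow> complex"
  assumes \<nu>: "vector_norm \<nu>"
    and diag: "\<And>e v C. (\<And>i. cmod (e i) \<le> C) \<Longrightarrow> \<nu> (\<chi> i. e i * v $ i) \<le> C * \<nu> v"
    and gap: "\<And>i. Re (d i) \<le> - \<alpha> \<or> \<beta> \<le> Re (d i)"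
    and y_der: "\<And>i s. s \<noteq> 0 \<Longrightarrow> ((\<lambda>s. y s $ i) has_vector_derivative d i * y s $ i + w s $ i) (at s)"
    and y_cont: "\<And>i. continuous_on UNIV (\<lambda>s. y s $ i)"
    and y_lim: "\<And>i. ((\<lambda>s. y s $ i) \<longlongrightarrow> 0) at_bot" "\<And>i. ((\<lambda>s. y s $ i) \<longlongrightarrow> 0) at_top"
    and w: "\<And>s. s \<noteq> 0 \<Longrightarrow> \<nu> (w s) \<le> M * green_h \<alpha> \<beta> k s"
    and \<alpha>: "\<alpha> > 0" and \<beta>: "\<beta> > 0" and t: "t \<noteq> 0"
  shows "\<nu> (y t) \<le> M * green_h \<alpha> \<beta> (Suc k) t"
proof -
  obtain c where cy: "inner c (y t) = \<nu> (y t)" and c: "\<And>v. inner c v \<le> \<nu> v"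
    using vector_norm_functional[OF \<nu>, of "y t"] by blast
  have stable: "inner c (\<chi> i. if Re (d i) < 0 then y t $ i else 0) \<le> M * green_a \<alpha> \<beta> k t"
  proof (rule stable_part_bound[where y = y and w = w and d = d and t = t and M = M
        and a = "green_a \<alpha> \<beta> k" and h = "green_h \<alpha> \<beta> k" and \<alpha> = \<alpha>, OF diag c])
    show "Re (d i) \<le> - \<alpha>" if "Re (d i) < 0" for i using gap[of i] that \<beta> by linarith
    show "(green_a \<alpha> \<beta> k has_real_derivative - \<alpha> * green_a \<alpha> \<beta> k s + green_h \<alpha> \<beta> k s) (at s)" if "s \<noteq> 0" for s
      using that \<alpha> \<beta> by (intro has_real_derivative_green_a) auto
  qed (use \<alpha> \<beta> y_der y_cont y_lim w in \<open>auto intro: continuous_green_a green_a_at_bot\<close>)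
  have "inner c (\<chi> i. if Re (- d i) < 0 then y (- (- t)) $ i else 0) \<le> M * green_a \<beta> \<alpha> k (- t)"
  proof (rule stable_part_bound[where y = "\<lambda>s. y (- s)" and w = "\<lambda>s. - w (- s)" and d = "\<lambda>i. - d i"
        and t = "- t" and M = M and a = "green_a \<beta> \<alpha> k" and h = "green_h \<beta> \<alpha> k" and \<alpha> = \<beta>, OF diag c])
    show "Re (- d i) \<le> - \<beta>" if "Re (- d i) < 0" for i using gap[of i] that \<alpha> by simp
    show "((\<lambda>s. y (- s) $ i) has_vector_derivative - d i * y (- s) $ i + (- w (- s)) $ i) (at s)" if "s \<noteq> 0" for i s
    proof -
      have "((\<lambda>s. y s $ i) has_vector_derivative d i * y (- s) $ i + w (- s) $ i) (at (- s))"
        using y_der[of "- s"] that by simp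
      then have "((\<lambda>s. y s $ i) \<circ> uminus has_vector_derivative (- 1) *\<^sub>R (d i * y (- s) $ i + w (- s) $ i)) (at s)"
        by (intro vector_diff_chain_at) (auto intro!: derivative_eq_intros)
      then show ?thesis by (simp add: o_def)
    qed
    show "\<nu> (- w (- s)) \<le> M * green_h \<beta> \<alpha> k s" if "s \<noteq> 0" for s
    proof -
      have "\<nu> (- w (- s)) = \<nu> ((- 1) *s w (- s))" by simp
      also have "\<dots> = \<nu> (w (- s))" using \<nu> unfolding vector_norm_def by (metis norm_minus_cancel norm_one mult_1)
      finally show ?thesis using w[of "- s"] that by (simp add: green_h_reflect)
    qed
    show "continuous_on UNIV (\<lambda>s. y (- s) $ i)" for i
      by (rule continuous_on_compose2[OF y_cont]) (auto intro: continuous_intros)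
    show "((\<lambda>s. y (- s) $ i) \<longlongrightarrow> 0) at_bot" for i
      using y_lim(2) by (simp add: filterlim_at_bot_mirror)
    show "(green_a \<beta> \<alpha> k has_real_derivative - \<beta> * green_a \<beta> \<alpha> k s + green_h \<beta> \<alpha> k s) (at s)" if "s \<noteq> 0" for s
      using that \<alpha> \<beta> by (intro has_real_derivative_green_a) auto
  qed (use \<alpha> \<beta> in \<open>auto intro: continuous_green_a green_a_at_bot\<close>)
  then have "inner c (\<chi> i. if Re (d i) > 0 then y t $ i else 0) \<le> M * green_a \<beta> \<alpha> k (- t)"
    unfolding minus_minus by simp
  \<comment> \<open>The gap excludes exponents on the imaginary axis, so the two halves exhaust the
    coordinates.\<close>
  moreover have "inner c (y t) = inner c (\<chi> i. if Re (d i) < 0 then y t $ i else 0)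
      + inner c (\<chi> i. if Re (d i) > 0 then y t $ i else 0)"
    unfolding inner_right_distrib[symmetric]
  proof (rule arg_cong[where f = "inner c"])
    have "Re (d i) \<noteq> 0" for i using gap[of i] \<alpha> \<beta> by linarith
    then show "y t = (\<chi> i. if Re (d i) < 0 then y t $ i else 0) + (\<chi> i. if Re (d i) > 0 then y t $ i else 0)"
      by (auto simp: vec_eq_iff)
  qed
  ultimately have "inner c (y t) \<le> M * green_a \<alpha> \<beta> k t + M * green_a \<beta> \<alpha> k (- t)"
    using stable by linarith
  then show ?thesis unfolding cy green_h_Suc[OF t] by (simp add: distrib_left)
qed

section \<open>Rational functions and their transforms\<close>

text \<open>\<^const>\<open>green_scalar\<close> with its right limit as value at \<open>t = 0\<close>, which makes the jump-free
  combinations below continuous there.\<close>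

definition green_scalar_right :: "real \<Rightarrow> complex \<Rightarrow> complex" where
  "green_scalar_right t z =
     (if 0 \<le> t then (if Re z < 0 then exp (z * of_real t) else 0)
      else (if 0 < Re z then - exp (z * of_real t) else 0))"

lemma green_scalar_right_eq: "t \<noteq> 0 \<Longrightarrow> green_scalar_right t z = green_scalar t z"
  by (auto simp: green_scalar_right_def green_scalar_def)

lemma has_vector_derivative_exp_of_real:
  fixes z :: complex
  shows "((\<lambda>t. exp (z * of_real t)) has_vector_derivative z * exp (z * of_real t)) (at t within S)"
proof -
  have "((\<lambda>w. exp (z * w)) has_field_derivative z * exp (z * of_real t)) (at (of_real t))"
    by (auto intro!: derivative_eq_intros)
  then show ?thesis
    using has_vector_derivative_real_field has_vector_derivative_at_within by fastforce
qed

lemma has_vector_derivative_green_scalar_right: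
  assumes "t \<noteq> 0"
  shows "((\<lambda>t. green_scalar_right t z) has_vector_derivative z * green_scalar_right t z) (at t)"
proof (cases "t > 0")
  case True
  have "((\<lambda>t. if Re z < 0 then exp (z * of_real t) else 0) has_vector_derivative z * green_scalar_right t z) (at t)"
    using True has_vector_derivative_exp_of_real[of z t UNIV] by (auto simp: green_scalar_right_def)
  then show ?thesis
    by (rule has_vector_derivative_transform_within_open[of _ _ _ "{0<..}"])
      (use True in \<open>auto simp: green_scalar_right_def\<close>)
next
  case False
  then have "t < 0" using assms by simp
  have "((\<lambda>t. if 0 < Re z then - exp (z * of_real t) else 0) has_vector_derivative z * green_scalar_right t z) (at t)"
    using \<open>t < 0\<close> has_vector_derivative_minus[OF has_vector_derivative_exp_of_real[of z t UNIV]]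
    by (auto simp: green_scalar_right_def)
  then show ?thesis
    by (rule has_vector_derivative_transform_within_open[of _ _ _ "{..<0}"])
      (use \<open>t < 0\<close> in \<open>auto simp: green_scalar_right_def\<close>)
qed

text \<open>\<open>green_pair Z r T\<close>: the rational function \<open>r\<close> has its poles in \<open>Z\<close> and vanishes at infinity,
  and \<open>T t\<close> is the contour integral of \<open>r\<close> against \<^term>\<open>green_scalar t\<close>, given explicitly
  through the partial fraction decomposition.\<close>

inductive green_pair :: "complex set \<Rightarrow> (complex \<Rightarrow> complex) \<Rightarrow> (real \<Rightarrow> complex) \<Rightarrow> bool" for Z where
  green_pair_base: "d \<in> Z \<Longrightarrow>
    green_pair Z (\<lambda>z. 1 / (z - d) ^ Suc m) (\<lambda>t. green_scalar_right t d * of_real t ^ m / fact m)"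
| green_pair_zero: "green_pair Z (\<lambda>z. 0) (\<lambda>t. 0)"
| green_pair_add: "green_pair Z r T \<Longrightarrow> green_pair Z r' T' \<Longrightarrow> green_pair Z (\<lambda>z. r z + r' z) (\<lambda>t. T t + T' t)"
| green_pair_scale: "green_pair Z r T \<Longrightarrow> green_pair Z (\<lambda>z. c * r z) (\<lambda>t. c * T t)"

lemma green_pair_sum:
  "finite I \<Longrightarrow> (\<And>i. i \<in> I \<Longrightarrow> green_pair Z (r i) (T i)) \<Longrightarrow>
    green_pair Z (\<lambda>z. \<Sum>i\<in>I. r i z) (\<lambda>t. \<Sum>i\<in>I. T i t)"
  by (induction I rule: finite_induct) (auto intro: green_pair.intros)

text \<open>On each half-line only exponentials decaying in its direction survive, and they beat the
  polynomial factors.\<close>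

lemma green_pair_lim:
  assumes "green_pair Z r T" and Z: "\<And>d. d \<in> Z \<Longrightarrow> Re d \<noteq> 0"
  shows "(T \<longlongrightarrow> 0) at_bot" "(T \<longlongrightarrow> 0) at_top"
proof -
  have "(T \<longlongrightarrow> 0) at_bot \<and> (T \<longlongrightarrow> 0) at_top"
    using assms(1)
  proof (induction rule: green_pair.induct)
    case (green_pair_base d m)
    have bot: "((\<lambda>t. green_scalar_right t d * of_real t ^ m / fact m) \<longlongrightarrow> 0) at_bot"
    proof (cases "Re d > 0")
      case True
      have "((\<lambda>t. exp (Re d * t) * (- t) ^ m / fact m) \<longlongrightarrow> 0 / fact m) at_bot"
        by (intro tendsto_divide tendsto_exp_mult_power_at_bot True tendsto_const) auto
      then have lim: "((\<lambda>t. exp (Re d * t) * (- t) ^ m / fact m) \<longlongrightarrow> 0) at_bot" by simp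
      show ?thesis
      proof (rule Lim_null_comparison[OF _ lim])
        show "\<forall>\<^sub>F t in at_bot. cmod (green_scalar_right t d * of_real t ^ m / fact m) \<le> exp (Re d * t) * (- t) ^ m / fact m"
          by (rule eventually_mono[OF eventually_gt_at_bot[of 0]])
            (use True in \<open>simp add: green_scalar_right_def norm_mult norm_divide norm_power\<close>)
      qed
    next
      case False
      show ?thesis
        by (rule tendsto_eventually, rule eventually_mono[OF eventually_gt_at_bot[of 0]])
          (use False in \<open>simp add: green_scalar_right_def\<close>)
    qed
    have top: "((\<lambda>t. green_scalar_right t d * of_real t ^ m / fact m) \<longlongrightarrow> 0) at_top"
    proof (cases "Re d < 0")
      case True
      have "((\<lambda>t. exp (- Re d * t) * (- t) ^ m / fact m) \<longlongrightarrow> 0 / fact m) at_bot"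
        using True by (intro tendsto_divide tendsto_exp_mult_power_at_bot tendsto_const) auto
      then have lim: "((\<lambda>t. exp (Re d * t) * t ^ m / fact m) \<longlongrightarrow> 0) at_top"
        by (simp add: filterlim_at_bot_mirror)
      show ?thesis
      proof (rule Lim_null_comparison[OF _ lim])
        show "\<forall>\<^sub>F t in at_top. cmod (green_scalar_right t d * of_real t ^ m / fact m) \<le> exp (Re d * t) * t ^ m / fact m"
          by (rule eventually_mono[OF eventually_gt_at_top[of 0]])
            (use True in \<open>simp add: green_scalar_right_def norm_mult norm_divide norm_power\<close>)
      qed
    next
      case False
      show ?thesis
        by (rule tendsto_eventually, rule eventually_mono[OF eventually_gt_at_top[of 0]])
          (use False in \<open>simp add: green_scalar_right_def\<close>)
    qed
    show ?case using bot top by simp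
  next
    case (green_pair_add r T r' T')
    then show ?case using tendsto_add[of T 0 _ T' 0] by simp
  next
    case (green_pair_scale r T c)
    then show ?case using tendsto_mult_right_zero[of T _ c] by simp
  qed simp
  then show "(T \<longlongrightarrow> 0) at_bot" "(T \<longlongrightarrow> 0) at_top" by auto
qed

text \<open>The positive power of t vanishes where the other factor jumps.\<close>

lemma continuous_green_scalar_right_Suc:
  "continuous_on UNIV (\<lambda>t. green_scalar_right t d * of_real t ^ Suc m / fact (Suc m))"
proof -
  have "continuous_on ({0..} \<union> {..0}) (\<lambda>t::real.
     if 0 \<le> t then (if Re d < 0 then exp (d * of_real t) else 0) * of_real t ^ Suc m / fact (Suc m)
     else (if 0 < Re d then - exp (d * of_real t) else 0) * of_real t ^ Suc m / fact (Suc m))"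
    by (rule continuous_on_If) (cases "Re d < 0"; cases "0 < Re d"; auto intro!: continuous_intros simp del: fact_Suc)+
  moreover have "{0..} \<union> {..0} = (UNIV :: real set)" by auto
  moreover have "(\<lambda>t. green_scalar_right t d * of_real t ^ Suc m / fact (Suc m)) = (\<lambda>t.
     if 0 \<le> t then (if Re d < 0 then exp (d * of_real t) else 0) * of_real t ^ Suc m / fact (Suc m)
     else (if 0 < Re d then - exp (d * of_real t) else 0) * of_real t ^ Suc m / fact (Suc m))"
    by (rule ext) (simp only: green_scalar_right_def split: if_split, blast)
  ultimately show ?thesis by (simp only:)
qed

text \<open>The jump at 0 is from 0 to 1 for Re d < 0 and from -1 to 0 for Re d > 0: it is always 1
  and cancels.\<close>

lemma continuous_green_scalar_right_diff:
  assumes "Re d \<noteq> 0" "Re d' \<noteq> 0"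
  shows "continuous_on UNIV (\<lambda>t. green_scalar_right t d - green_scalar_right t d')"
proof -
  have "continuous_on ({0..} \<union> {..0}) (\<lambda>t::real.
     if 0 \<le> t then (if Re d < 0 then exp (d * of_real t) else 0) - (if Re d' < 0 then exp (d' * of_real t) else 0)
     else (if 0 < Re d then - exp (d * of_real t) else 0) - (if 0 < Re d' then - exp (d' * of_real t) else 0))"
    by (rule continuous_on_If) (use assms in \<open>cases "Re d < 0"; cases "Re d' < 0"; auto intro!: continuous_intros\<close>)+
  moreover have "{0..} \<union> {..0} = (UNIV :: real set)" by auto
  moreover have "(\<lambda>t. green_scalar_right t d - green_scalar_right t d') = (\<lambda>t.
     if 0 \<le> t then (if Re d < 0 then exp (d * of_real t) else 0) - (if Re d' < 0 then exp (d' * of_real t) else 0)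
     else (if 0 < Re d then - exp (d * of_real t) else 0) - (if 0 < Re d' then - exp (d' * of_real t) else 0))"
    by (rule ext) (simp only: green_scalar_right_def split: if_split, blast)
  ultimately show ?thesis by (simp only:)
qed

text \<open>Dividing by z - d corresponds to solving a linear equation with source \<open>T\<close>.
  Since \<open>r\<close> vanishes at infinity, the quotient decays at least like 1 / z^2, whence a
  transform without a jump. The quotients are compared only off \<open>Z\<close>, because at a pole
  the two expressions may take different default values.\<close>

definition green_division :: "complex set \<Rightarrow> complex \<Rightarrow> (complex \<Rightarrow> complex) \<Rightarrow> (real \<Rightarrow> complex)
    \<Rightarrow> (complex \<Rightarrow> complex) \<Rightarrow> (real \<Rightarrow> complex) \<Rightarrow> bool" where
  "green_division Z d r T r' T' \<longleftrightarrow> green_pair Z r' T' \<and> (\<forall>z. z \<notin> Z \<longrightarrow> r' z = r z / (z - d)) \<and>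
     (\<forall>t. t \<noteq> 0 \<longrightarrow> (T' has_vector_derivative d * T' t + T t) (at t)) \<and> continuous_on UNIV T'"

lemma green_scalar_right_power_derivative:
  assumes "t \<noteq> 0"
  shows "((\<lambda>t. green_scalar_right t d * of_real t ^ Suc m / fact (Suc m)) has_vector_derivative
    d * (green_scalar_right t d * of_real t ^ Suc m / fact (Suc m)) + green_scalar_right t d * of_real t ^ m / fact m) (at t)"
proof -
  have "((\<lambda>z::complex. z ^ Suc m / fact (Suc m)) has_field_derivative of_real t ^ m / fact m) (at (of_real t))"
  proof -
    have "((\<lambda>z::complex. z ^ Suc m / fact (Suc m)) has_field_derivative of_nat (Suc m) * of_real t ^ m / fact (Suc m)) (at (of_real t))"
      by (intro DERIV_cdivide) (rule DERIV_cong[OF DERIV_power_Suc[OF DERIV_ident]], simp)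
    then show ?thesis by (simp del: of_nat_Suc)
  qed
  then have "((\<lambda>t. of_real t ^ Suc m / fact (Suc m) :: complex) has_vector_derivative of_real t ^ m / fact m) (at t)"
    by (rule has_vector_derivative_real_field)
  then have "((\<lambda>t. green_scalar_right t d * (of_real t ^ Suc m / fact (Suc m))) has_vector_derivative
      green_scalar_right t d * (of_real t ^ m / fact m) + d * green_scalar_right t d * (of_real t ^ Suc m / fact (Suc m))) (at t)"
    by (rule has_vector_derivative_mult[OF has_vector_derivative_green_scalar_right[OF assms]])
  then show ?thesis by (simp add: mult.assoc add.commute del: power_Suc fact_Suc)
qed

text \<open>If the poles coincide, the order rises by one. Otherwise 1 / (z - d0) is moved inwards
  by (z - d0) - (z - d) = d - d0, which lowers the order at d until a difference of two simple
  fractions is left.\<close>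

lemma green_division_base:
  assumes d: "d \<in> Z" and d0: "d0 \<in> Z" and Z: "\<And>d. d \<in> Z \<Longrightarrow> Re d \<noteq> 0"
  shows "\<exists>r' T'. green_division Z d0 (\<lambda>z. 1 / (z - d) ^ Suc m)
    (\<lambda>t. green_scalar_right t d * of_real t ^ m / fact m) r' T'"
proof (cases "d = d0")
  case True
  have "green_division Z d0 (\<lambda>z. 1 / (z - d) ^ Suc m) (\<lambda>t. green_scalar_right t d * of_real t ^ m / fact m)
     (\<lambda>z. 1 / (z - d) ^ Suc (Suc m)) (\<lambda>t. green_scalar_right t d * of_real t ^ Suc m / fact (Suc m))"
    unfolding green_division_def
  proof (intro conjI allI impI)
    show "green_pair Z (\<lambda>z. 1 / (z - d) ^ Suc (Suc m)) (\<lambda>t. green_scalar_right t d * of_real t ^ Suc m / fact (Suc m))"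
      by (rule green_pair_base[OF d])
    show "1 / (z - d) ^ Suc (Suc m) = 1 / (z - d) ^ Suc m / (z - d0)" for z
      by (simp add: True)
  qed (use green_scalar_right_power_derivative[of _ d m] continuous_green_scalar_right_Suc[of d m] True in blast)+
  then show ?thesis by blast
next
  case False
  then have nz: "d - d0 \<noteq> 0" by simp
  show ?thesis
  proof (induction m)
    case 0
    define r' where "r' z = 1 / (d - d0) * (1 / (z - d) ^ Suc 0 + - 1 * (1 / (z - d0) ^ Suc 0))" for z
    define T' where "T' t = 1 / (d - d0) * (green_scalar_right t d * of_real t ^ 0 / fact 0
      + - 1 * (green_scalar_right t d0 * of_real t ^ 0 / fact 0))" for t
    have "green_pair Z r' T'"
      unfolding r'_def T'_def by (intro green_pair.intros d d0)
    moreover have "r' z = 1 / (z - d) ^ Suc 0 / (z - d0)" if "z \<notin> Z" for z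
    proof -
      have "z - d \<noteq> 0" "z - d0 \<noteq> 0" using that d d0 by auto
      then show ?thesis using nz unfolding r'_def by (simp add: divide_simps)
    qed
    moreover have "(T' has_vector_derivative d0 * T' t + green_scalar_right t d * of_real t ^ 0 / fact 0) (at t)"
      if "t \<noteq> 0" for t
    proof -
      have "((\<lambda>t. 1 / (d - d0) * (green_scalar_right t d - green_scalar_right t d0)) has_vector_derivative
        1 / (d - d0) * (d * green_scalar_right t d - d0 * green_scalar_right t d0)) (at t)"
        by (intro has_vector_derivative_mult_right has_vector_derivative_diff has_vector_derivative_green_scalar_right that)
      moreover have "1 / (d - d0) * (d * green_scalar_right t d - d0 * green_scalar_right t d0)
         = d0 * T' t + green_scalar_right t d * of_real t ^ 0 / fact 0"
        using nz by (simp add: T'_def field_simps)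
      ultimately show ?thesis by (simp add: T'_def[abs_def])
    qed
    moreover have "continuous_on UNIV T'"
      using continuous_on_mult_left[OF continuous_green_scalar_right_diff[OF Z[OF d] Z[OF d0]], of "1 / (d - d0)"]
      by (simp add: T'_def[abs_def])
    ultimately show ?case unfolding green_division_def by blast
  next
    case (Suc m)
    define T where "T m t = green_scalar_right t d * of_real t ^ m / fact m" for m t
    obtain r1 T1 where 1: "green_pair Z r1 T1" "\<And>z. z \<notin> Z \<Longrightarrow> r1 z = 1 / (z - d) ^ Suc m / (z - d0)"
      "\<And>t. t \<noteq> 0 \<Longrightarrow> (T1 has_vector_derivative d0 * T1 t + T m t) (at t)" "continuous_on UNIV T1"
      using Suc unfolding green_division_def T_def by blast
    define r' where "r' z = 1 / (d - d0) * (1 / (z - d) ^ Suc (Suc m) + - 1 * r1 z)" for z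
    define T' where "T' t = 1 / (d - d0) * (T (Suc m) t + - 1 * T1 t)" for t
    have "green_pair Z r' T'"
      unfolding r'_def T'_def T_def by (intro green_pair.intros d 1)
    moreover have "r' z = 1 / (z - d) ^ Suc (Suc m) / (z - d0)" if "z \<notin> Z" for z
    proof -
      have z: "z - d \<noteq> 0" "z - d0 \<noteq> 0" using that d d0 by auto
      define x where "x = (z - d) ^ Suc m"
      have x: "x \<noteq> 0" "(z - d) ^ Suc (Suc m) = (z - d) * x" using z by (simp_all add: x_def)
      show ?thesis unfolding r'_def 1(2)[OF that] x(2) x_def[symmetric] using nz z x(1)
        by (simp add: divide_simps)
    qed
    moreover have "(T' has_vector_derivative d0 * T' t + T (Suc m) t) (at t)" if "t \<noteq> 0" for t
    proof -
      have "(T' has_vector_derivative 1 / (d - d0) * ((d * T (Suc m) t + T m t) + - 1 * (d0 * T1 t + T m t))) (at t)"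
        unfolding T'_def
        by (intro has_vector_derivative_mult_right has_vector_derivative_add 1(3) that)
          (use green_scalar_right_power_derivative[OF that] in \<open>simp add: T_def del: fact_Suc power_Suc\<close>)
      moreover have "1 / (d - d0) * ((d * T (Suc m) t + T m t) + - 1 * (d0 * T1 t + T m t)) = d0 * T' t + T (Suc m) t"
        using nz by (simp add: T'_def field_simps)
      ultimately show ?thesis by simp
    qed
    moreover have "continuous_on UNIV T'"
      unfolding T'_def T_def by (intro continuous_intros 1(4) continuous_green_scalar_right_Suc)
    ultimately show ?case unfolding green_division_def T_def by blast
  qed
qed

lemma green_division_exists:
  assumes "green_pair Z r T" and d0: "d0 \<in> Z" and Z: "\<And>d. d \<in> Z \<Longrightarrow> Re d \<noteq> 0"
  shows "\<exists>r' T'. green_division Z d0 r T r' T'"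
  using assms(1)
proof (induction rule: green_pair.induct)
  case (green_pair_base d m)
  then show ?case by (rule green_division_base[OF _ d0 Z])
next
  case green_pair_zero
  have "green_division Z d0 (\<lambda>z. 0) (\<lambda>t. 0) (\<lambda>z. 0) (\<lambda>t. 0)"
    by (simp add: green_division_def green_pair.intros)
  then show ?case by blast
next
  case (green_pair_add r1 T1 r2 T2)
  then obtain r1' T1' r2' T2' where "green_division Z d0 r1 T1 r1' T1'" "green_division Z d0 r2 T2 r2' T2'"
    by blast
  then have "green_division Z d0 (\<lambda>z. r1 z + r2 z) (\<lambda>t. T1 t + T2 t) (\<lambda>z. r1' z + r2' z) (\<lambda>t. T1' t + T2' t)"
    unfolding green_division_def
    by (auto intro: green_pair.intros continuous_intros simp: add_divide_distrib
       intro!: has_vector_derivative_eq_rhs[OF has_vector_derivative_add] simp: algebra_simps)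
  then show ?case by blast
next
  case (green_pair_scale r T c)
  then obtain r' T' where "green_division Z d0 r T r' T'" by blast
  then have "green_division Z d0 (\<lambda>z. c * r z) (\<lambda>t. c * T t) (\<lambda>z. c * r' z) (\<lambda>t. c * T' t)"
    unfolding green_division_def
    by (auto intro: green_pair.intros continuous_intros
       intro!: has_vector_derivative_eq_rhs[OF has_vector_derivative_mult_right] simp: algebra_simps)
  then show ?case by blast
qed

section \<open>Contours\<close>

lemma higher_deriv_exp_mult:
  "(deriv ^^ n) (\<lambda>z. c * exp (z * a)) = (\<lambda>z::complex. c * a ^ n * exp (z * a))"
proof (induction n)
  case (Suc n)
  have "deriv (\<lambda>z. c * a ^ n * exp (z * a)) z = c * a ^ Suc n * exp (z * a)" for z
    by (rule DERIV_imp_deriv) (auto intro!: derivative_eq_intros)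
  then show ?case unfolding funpow.simps o_apply Suc by (rule ext)
qed simp

text \<open>A connected curve off the imaginary axis lies in one half-plane, where
  \<open>green_scalar t\<close> agrees with a multiple of an exponential. That multiple is entire,
  so the residue theorem applies on the whole plane, and the m-th derivative produces the power of
  t.\<close>

lemma contour_integral_green_scalar:
  assumes p: "valid_path p" "pathfinish p = pathstart p"
    and axis: "path_image p \<inter> {z. Re z = 0} = {}"
    and d: "d \<notin> path_image p" "Re d \<noteq> 0" and t: "t \<noteq> 0"
  shows "((\<lambda>z. green_scalar t z * (1 / (z - d) ^ Suc m)) has_contour_integral
    2 * of_real pi * \<i> * winding_number p d * (green_scalar t d * of_real t ^ m / fact m)) p"
proof -
  have conn: "connected (Re ` path_image p)"
    by (intro connected_continuous_image continuous_intros connected_path_image valid_path_imp_path p)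
  have zero: "0 \<notin> Re ` path_image p" using axis by auto
  have side: "(\<forall>z\<in>path_image p. Re z < 0) \<or> (\<forall>z\<in>path_image p. Re z > 0)"
  proof (rule ccontr)
    assume "\<not> ((\<forall>z\<in>path_image p. Re z < 0) \<or> (\<forall>z\<in>path_image p. Re z > 0))"
    then obtain z w where "z \<in> path_image p" "w \<in> path_image p" "Re z \<le> 0" "0 \<le> Re w"
      by (auto simp: not_less)
    then have "0 \<in> Re ` path_image p"
      using conn by (auto dest: connectedD_interval[of _ "Re z" "Re w" 0])
    then show False using zero by blast
  qed
  obtain H c where H: "convex H" "path_image p \<subseteq> H" "H = {z. Re z < 0} \<or> H = {z. Re z > 0}"
    and c: "\<And>z. z \<in> H \<Longrightarrow> green_scalar t z = c * exp (z * of_real t)"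
  proof (cases "\<forall>z\<in>path_image p. Re z < 0")
    case True
    show thesis
      by (rule that[of "{z. Re z < 0}" "if 0 < t then 1 else 0"])
        (use True t in \<open>auto simp: green_scalar_def convex_halfspace_Re_lt\<close>)
  next
    case False
    show thesis
      by (rule that[of "{z. Re z > 0}" "if t < 0 then - 1 else 0"])
        (use False side t in \<open>auto simp: green_scalar_def convex_halfspace_Re_gt\<close>)
  qed
  define f where "f z = c * exp (z * of_real t)" for z
  have holo: "f holomorphic_on UNIV" unfolding f_def by (intro holomorphic_intros)
  have integrand: "(\<lambda>z. f z / (z - d) ^ Suc m) holomorphic_on UNIV - {d}"
    by (intro holomorphic_intros holomorphic_on_subset[OF holo]) auto
  have "contour_integral p (\<lambda>z. f z / (z - d) ^ Suc m)
      = 2 * of_real pi * \<i> * (\<Sum>a\<in>{d}. winding_number p a * residue (\<lambda>z. f z / (z - d) ^ Suc m) a)"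
    using Residue_theorem[of UNIV "{d}" "\<lambda>z. f z / (z - d) ^ Suc m" p] p d integrand
    by (simp add: connected_UNIV subset_Compl_singleton Diff_eq del: power_Suc)
  also have "\<dots> = 2 * of_real pi * \<i> * (winding_number p d * residue (\<lambda>z. f z / (z - d) ^ Suc m) d)"
    by simp
  also have "residue (\<lambda>z. f z / (z - d) ^ Suc m) d = (deriv ^^ m) f d / fact m"
    by (rule residue_holomorphic_over_power[OF _ _ holo]) auto
  also have "(deriv ^^ m) f d = of_real t ^ m * f d"
    unfolding f_def higher_deriv_exp_mult by simp
  finally have "contour_integral p (\<lambda>z. f z / (z - d) ^ Suc m)
      = 2 * of_real pi * \<i> * winding_number p d * (f d * of_real t ^ m / fact m)"
    by (simp add: mult_ac)
  also have "\<dots> = 2 * of_real pi * \<i> * winding_number p d * (green_scalar t d * of_real t ^ m / fact m)"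
  proof (cases "d \<in> H")
    case True
    then show ?thesis using c by (simp add: f_def)
  next
    \<comment> \<open>The entire extension is the wrong function at a \<open>d\<close> on the other
      side, but such a point has winding number 0.\<close>
    case False
    then have "winding_number p d = 0"
      using winding_number_zero_outside[OF valid_path_imp_path[OF p(1)] H(1) p(2) False H(2)] by simp
    then show ?thesis by simp
  qed
  finally have I: "contour_integral p (\<lambda>z. f z / (z - d) ^ Suc m)
      = 2 * of_real pi * \<i> * winding_number p d * (green_scalar t d * of_real t ^ m / fact m)" .
  have "(\<lambda>z. f z / (z - d) ^ Suc m) contour_integrable_on p"
    by (rule contour_integrable_holomorphic_simple[OF integrand]) (use p d in auto)
  then have "((\<lambda>z. f z / (z - d) ^ Suc m) has_contour_integral
    2 * of_real pi * \<i> * winding_number p d * (green_scalar t d * of_real t ^ m / fact m)) p"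
    unfolding I[symmetric] by (rule has_contour_integral_integral)
  then show ?thesis
    by (rule has_contour_integral_eq) (use H c in \<open>auto simp: f_def\<close>)
qed

text \<open>Linearity reduces this to single fractions, where the winding numbers of the components
  add up to 1. Integrability is carried through the induction because additivity depends on
  it.\<close>

lemma contour_integral_green_pair:
  assumes "green_pair Z r T"
    and \<Gamma>: "\<And>p. p \<in> set \<Gamma> \<Longrightarrow> valid_path p \<and> pathfinish p = pathstart p \<and> path_image p \<inter> {z. Re z = 0} = {}"
    and Z: "\<And>d. d \<in> Z \<Longrightarrow> Re d \<noteq> 0 \<and> d \<notin> contour_image \<Gamma> \<and> contour_winding \<Gamma> d = 1"
    and t: "t \<noteq> 0"
  shows "(\<forall>p\<in>set \<Gamma>. (\<lambda>z. green_scalar t z * r z) contour_integrable_on p) \<and>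
    (\<Sum>p\<leftarrow>\<Gamma>. contour_integral p (\<lambda>z. green_scalar t z * r z)) = 2 * of_real pi * \<i> * T t"
  using assms(1)
proof (induction rule: green_pair.induct)
  case (green_pair_base d m)
  define G where "G = green_scalar t d * of_real t ^ m / fact m"
  have I: "((\<lambda>z. green_scalar t z * (1 / (z - d) ^ Suc m)) has_contour_integral
      2 * of_real pi * \<i> * winding_number p d * G) p" if "p \<in> set \<Gamma>" for p
    unfolding G_def
    by (rule contour_integral_green_scalar)
      (use \<Gamma>[OF that] Z[OF green_pair_base] t that in \<open>auto simp: contour_image_def\<close>)
  then have "(\<Sum>p\<leftarrow>\<Gamma>. contour_integral p (\<lambda>z. green_scalar t z * (1 / (z - d) ^ Suc m)))
      = (\<Sum>p\<leftarrow>\<Gamma>. 2 * of_real pi * \<i> * G * winding_number p d)"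
    by (intro arg_cong[where f = sum_list] map_cong refl)
      (use contour_integral_unique in \<open>force simp: mult_ac\<close>)
  also have "\<dots> = 2 * of_real pi * \<i> * G * contour_winding \<Gamma> d"
    unfolding contour_winding_def by (rule sum_list_const_mult)
  finally show ?case
    using I Z[OF green_pair_base] t
    by (auto simp: G_def green_scalar_right_eq intro: has_contour_integral_integrable)
next
  case (green_pair_add r T r' T')
  have "(\<Sum>p\<leftarrow>\<Gamma>. contour_integral p (\<lambda>z. green_scalar t z * (r z + r' z)))
     = (\<Sum>p\<leftarrow>\<Gamma>. contour_integral p (\<lambda>z. green_scalar t z * r z) + contour_integral p (\<lambda>z. green_scalar t z * r' z))"
    using green_pair_add.IH by (intro arg_cong[where f = sum_list] map_cong refl)
      (simp add: distrib_left contour_integral_add)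
  then show ?case
    using green_pair_add.IH by (simp add: sum_list_addf distrib_left contour_integrable_add)
next
  case (green_pair_scale r T c)
  have "(\<Sum>p\<leftarrow>\<Gamma>. contour_integral p (\<lambda>z. green_scalar t z * (c * r z)))
     = (\<Sum>p\<leftarrow>\<Gamma>. c * contour_integral p (\<lambda>z. green_scalar t z * r z))"
    using green_pair_scale.IH by (intro arg_cong[where f = sum_list] map_cong refl)
      (simp add: mult.left_commute contour_integral_lmul)
  also have "\<dots> = c * (\<Sum>p\<leftarrow>\<Gamma>. contour_integral p (\<lambda>z. green_scalar t z * r z))"
    by (rule sum_list_const_mult)
  finally show ?case
    using green_pair_scale.IH
    by (simp add: mult.left_commute contour_integrable_lmul)
qed (simp add: has_contour_integral_integrable[OF has_contour_integral_0])

section \<open>Existence of an admissible contour\<close>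

lemma finite_left_half_plane_circle:
  assumes "finite Z" and "\<And>z. z \<in> Z \<Longrightarrow> Re z < 0"
  shows "\<exists>R \<rho>. 0 < \<rho> \<and> \<rho> < R \<and> Z \<subseteq> ball (- of_real R) \<rho>"
proof -
  \<comment> \<open>The discs with centre - R touching the axis at 0 grow with R and exhaust the
    open left half-plane.\<close>
  have "\<exists>R>0. \<forall>z\<in>Z. cmod (z + of_real R) < R"
    using assms
  proof (induction Z rule: finite_induct)
    case empty
    show ?case by (intro exI[of _ 1]) simp
  next
    case (insert z Z)
    then obtain R where R: "R > 0" "\<And>z. z \<in> Z \<Longrightarrow> cmod (z + of_real R) < R" by auto
    have "Re z < 0" using insert by simp
    \<comment> \<open>With this radius |z + S|^2 = |z|^2 + 2 S Re z + S^2 is at most S^2 + S Re z,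
      which is below S^2.\<close>
    define S where "S = max R ((cmod z)\<^sup>2 / (- Re z))"
    have "S > 0" using R by (simp add: S_def)
    have "S * (- Re z) \<ge> (cmod z)\<^sup>2"
      using \<open>Re z < 0\<close> by (subst pos_divide_le_eq[symmetric]) (auto simp: S_def)
    then have "(cmod (z + of_real S))\<^sup>2 \<le> S\<^sup>2 + S * Re z"
      unfolding cmod_power2 by (simp add: power2_eq_square algebra_simps)
    also have "\<dots> < S\<^sup>2" using \<open>S > 0\<close> \<open>Re z < 0\<close> by (simp add: mult_pos_neg)
    finally have z: "cmod (z + of_real S) < S"
      using \<open>S > 0\<close> by (simp add: power_less_imp_less_base)
    have "cmod (w + of_real S) < S" if "w \<in> Z" for w
    proof -
      have "cmod (w + of_real S) \<le> cmod (w + of_real R) + cmod (of_real (S - R))"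
        using norm_triangle_ineq[of "w + of_real R" "of_real (S - R)"] by simp
      also have "cmod (of_real (S - R)) = S - R" unfolding norm_of_real by (simp add: S_def)
      finally show ?thesis using R(2)[OF that] by simp
    qed
    then show ?case using z \<open>S > 0\<close> by auto
  qed
  then obtain R where R: "R > 0" "\<And>z. z \<in> Z \<Longrightarrow> cmod (z + of_real R) < R" by blast
  \<comment> \<open>By finiteness the points keep a positive distance from the boundary, so the
    radius (m + R) / 2 still encloses them and pulls the circle off the axis.\<close>
  define m where "m = Max (insert 0 ((\<lambda>z. cmod (z + of_real R)) ` Z))"
  have m: "0 \<le> m" "m < R" "\<And>z. z \<in> Z \<Longrightarrow> cmod (z + of_real R) \<le> m"
    using assms(1) R by (auto simp: m_def)
  show ?thesis
  proof (intro exI conjI)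
    show "Z \<subseteq> ball (- of_real R) ((m + R) / 2)"
    proof
      fix z assume "z \<in> Z"
      then have "cmod (z + of_real R) < (m + R) / 2" using m(2) m(3)[of z] by simp
      moreover have "dist (- of_real R) z = cmod (z + of_real R)"
        by (metis dist_commute dist_norm diff_minus_eq_add)
      ultimately show "z \<in> ball (- of_real R) ((m + R) / 2)" by simp
    qed
  qed (use m R in auto)
qed

lemma winding_number_circlepath_outside:
  assumes "\<rho> > 0" "z \<notin> cball c \<rho>"
  shows "winding_number (circlepath c \<rho>) z = 0"
  by (rule winding_number_zero_outside[of _ "cball c \<rho>"]) (use assms in auto)

text \<open>Gives the choice in \<open>green_function\<close> an actual contour: one circle in each
  half-plane, the right one obtained by reflection. A circle may enclose no eigenvalue.\<close>

lemma green_contour_exists: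
  assumes "finite (spectrum A)" and "\<And>z. z \<in> spectrum A \<Longrightarrow> Re z \<noteq> 0"
  shows "\<exists>\<Gamma>. green_contour A \<Gamma>"
proof -
  obtain R \<rho> where 1: "0 < \<rho>" "\<rho> < R" "{z \<in> spectrum A. Re z < 0} \<subseteq> ball (- of_real R) \<rho>"
    using finite_left_half_plane_circle[of "{z \<in> spectrum A. Re z < 0}", OF finite_subset[OF _ assms(1)]]
    by blast
  obtain S \<sigma> where 2: "0 < \<sigma>" "\<sigma> < S" "uminus ` {z \<in> spectrum A. Re z > 0} \<subseteq> ball (- of_real S) \<sigma>"
    using finite_left_half_plane_circle[of "uminus ` {z \<in> spectrum A. Re z > 0}", OF finite_imageI[OF finite_subset[OF _ assms(1)]]]
    by fastforce
  let ?p = "circlepath (- of_real R) \<rho>" and ?q = "circlepath (of_real S) \<sigma>"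
  have left: "Re z < 0" if "z \<in> cball (- of_real R) \<rho>" for z
    using that 1 complex_Re_le_cmod[of "z + of_real R"] by (auto simp: dist_norm norm_minus_commute)
  have right: "Re z > 0" if "z \<in> cball (of_real S) \<sigma>" for z
    using that 2 complex_Re_le_cmod[of "of_real S - z"] by (auto simp: dist_norm)
  have wp: "winding_number ?p z = (if z \<in> ball (- of_real R) \<rho> then 1 else 0)" if "z \<notin> path_image ?p" for z
    using that 1 winding_number_circlepath_outside[of \<rho> z "- of_real R"]
    by (auto simp: winding_number_circlepath dist_norm norm_minus_commute)
  have wq: "winding_number ?q z = (if z \<in> ball (of_real S) \<sigma> then 1 else 0)" if "z \<notin> path_image ?q" for z
    using that 2 winding_number_circlepath_outside[of \<sigma> z "of_real S"]
    by (auto simp: winding_number_circlepath dist_norm norm_minus_commute)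
  have pl: "path_image ?p \<subseteq> {z. Re z < 0}" using left 1 by (auto simp: sphere_def)
  have ql: "path_image ?q \<subseteq> {z. Re z > 0}" using right 2 by (auto simp: sphere_def)
  have disj: "\<not> ((z::complex) \<in> ball (- of_real R) \<rho> \<and> z \<in> ball (of_real S) \<sigma>)" for z
    using left[of z] right[of z] by auto
  have image: "contour_image [?p, ?q] = path_image ?p \<union> path_image ?q"
    by (simp add: contour_image_def)
  have wind: "contour_winding [?p, ?q] z = (if z \<in> ball (- of_real R) \<rho> \<union> ball (of_real S) \<sigma> then 1 else 0)"
    if "z \<notin> path_image ?p \<union> path_image ?q" for z
    using that wp[of z] wq[of z] disj[of z] by (auto simp: contour_winding_def simp del: mem_ball)
  have pq: "path_image ?p \<inter> path_image ?q = {}" using pl ql by fastforce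
  moreover have "path_image ?p \<noteq> {}" by (rule path_image_nonempty)
  ultimately have "?p \<noteq> ?q" by (metis Int_absorb)
  then have pos: "positively_oriented_contour [?p, ?q]"
    unfolding positively_oriented_contour_def image
    using 1 2 pq wind by (auto simp: simple_path_circlepath pairwise_def disjnt_def simp del: path_image_circlepath)
  have ball_image: "z \<notin> path_image ?p \<union> path_image ?q" if "z \<in> ball (- of_real R) \<rho> \<union> ball (of_real S) \<sigma>" for z
    using that 1 2 pl ql left[of z] right[of z] by (auto simp: sphere_def)
  have encl: "enclosed_region [?p, ?q] = ball (- of_real R) \<rho> \<union> ball (of_real S) \<sigma>"
    unfolding enclosed_region_def image using ball_image wind by (auto simp del: mem_ball path_image_circlepath split: if_splits)
  have "spectrum A \<subseteq> ball (- of_real R) \<rho> \<union> ball (of_real S) \<sigma>"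
  proof
    fix z assume z: "z \<in> spectrum A"
    show "z \<in> ball (- of_real R) \<rho> \<union> ball (of_real S) \<sigma>"
    proof (cases "Re z < 0")
      case True
      then show ?thesis using 1 z by auto
    next
      case False
      then have "- z \<in> uminus ` {z \<in> spectrum A. Re z > 0}" using z assms(2)[OF z] by auto
      then have "- z \<in> ball (- of_real S) \<sigma>" using 2(3) by blast
      then show ?thesis by (auto simp: dist_norm norm_minus_commute)
    qed
  qed
  moreover have "(contour_image [?p, ?q] \<union> enclosed_region [?p, ?q]) \<inter> {z. Re z = 0} = {}"
  proof -
    have "Re z \<noteq> 0" if "z \<in> contour_image [?p, ?q] \<union> enclosed_region [?p, ?q]" for z
      using that pl ql left[of z] right[of z] unfolding image encl
      by (auto simp del: path_image_circlepath)
    then show ?thesis by blast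
  qed
  ultimately have "green_contour A [?p, ?q]"
    using pos unfolding green_contour_def encl by blast
  then show ?thesis by blast
qed

section \<open>Matrices\<close>

lemma subadditive_sum_le:
  fixes p :: "'b::comm_monoid_add \<Rightarrow> real"
  assumes "p 0 = 0" and "\<And>x y. p (x + y) \<le> p x + p y"
  shows "p (\<Sum>i\<in>I. f i) \<le> (\<Sum>i\<in>I. p (f i))"
proof (induction I rule: infinite_finite_induct)
  case (insert i I)
  then show ?case using assms(2)[of "f i" "sum f I"] by simp
qed (simp_all add: assms(1))

lemma seminorm_le_norm:
  fixes p :: "complex ^ 'n \<Rightarrow> real"
  assumes hom: "\<And>c x. p (c *s x) = cmod c * p x" and tri: "\<And>x y. p (x + y) \<le> p x + p y"
    and nn: "\<And>x. 0 \<le> p x"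
  shows "p x \<le> norm x * (\<Sum>i\<in>UNIV. p (axis i 1))"
proof -
  have "p 0 = 0" using hom[of 0 0] by simp
  have "p x = p (\<Sum>i\<in>UNIV. x $ i *s axis i 1)" by (simp add: basis_expansion)
  also have "\<dots> \<le> (\<Sum>i\<in>UNIV. p (x $ i *s axis i 1))" by (rule subadditive_sum_le[OF \<open>p 0 = 0\<close> tri])
  also have "\<dots> = (\<Sum>i\<in>UNIV. cmod (x $ i) * p (axis i 1))" by (simp add: hom)
  also have "\<dots> \<le> (\<Sum>i\<in>UNIV. norm x * p (axis i 1))"
    by (intro sum_mono mult_right_mono nn) (rule Finite_Cartesian_Product.norm_nth_le)
  finally show ?thesis by (simp add: sum_distrib_left)
qed

text \<open>A norm is Lipschitz, so it attains a positive minimum on the compact Euclidean sphere;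
  homogeneity does the rest.\<close>

lemma norm_le_vector_norm:
  fixes \<nu> :: "complex ^ 'n \<Rightarrow> real"
  assumes "vector_norm \<nu>"
  shows "\<exists>C>0. \<forall>x. norm x \<le> C * \<nu> x"
proof -
  have nn: "0 \<le> \<nu> x" and nz: "\<nu> x = 0 \<longleftrightarrow> x = 0" and hom: "\<nu> (c *s x) = cmod c * \<nu> x"
    and tri: "\<nu> (x + y) \<le> \<nu> x + \<nu> y" for c x y
    using assms by (auto simp: vector_norm_def)
  define K where "K = (\<Sum>i\<in>UNIV. \<nu> (axis i 1 :: complex ^ 'n))"
  have K: "\<nu> x \<le> norm x * K" for x
    unfolding K_def by (rule seminorm_le_norm[OF hom tri nn])
  have lip: "\<nu> x - \<nu> y \<le> norm (x - y) * K" for x y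
    using tri[of "x - y" y] K[of "x - y"] by simp
  have "K \<ge> 0" by (simp add: K_def nn sum_nonneg)
  have "K-lipschitz_on UNIV \<nu>"
  proof (rule lipschitz_onI)
    fix x y :: "complex ^ 'n"
    show "dist (\<nu> x) (\<nu> y) \<le> K * dist x y"
      using lip[of x y] lip[of y x] by (simp add: dist_norm norm_minus_commute mult.commute abs_le_iff)
  qed (fact \<open>K \<ge> 0\<close>)
  then have "continuous_on (sphere 0 1) \<nu>"
    using lipschitz_on_continuous_on continuous_on_subset by blast
  moreover have "axis undefined 1 \<in> sphere (0 :: complex ^ 'n) 1" by (simp add: norm_axis_1)
  ultimately obtain u where u: "u \<in> sphere 0 1" "\<And>v. v \<in> sphere 0 1 \<Longrightarrow> \<nu> u \<le> \<nu> v"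
    using continuous_attains_inf[of "sphere 0 1" \<nu>] compact_sphere by blast
  have "u \<noteq> 0" using u(1) by auto
  then have pos: "\<nu> u > 0" using nn[of u] nz[of u] by linarith
  have "norm x \<le> 1 / \<nu> u * \<nu> x" for x
  proof (cases "x = 0")
    case False
    define v where "v = complex_of_real (1 / norm x) *s x"
    have "v = (1 / norm x) *\<^sub>R x"
      by (simp add: v_def vec_eq_iff scaleR_conv_of_real[where 'a = complex])
    then have "v \<in> sphere 0 1" using False by simp
    then have "\<nu> u \<le> \<nu> v" by (rule u(2))
    also have "\<nu> v = \<nu> x / norm x" unfolding v_def hom norm_of_real by simp
    finally show ?thesis using False pos by (simp add: field_simps)
  qed (simp add: nn)
  then show ?thesis using pos by (intro exI[of _ "1 / \<nu> u"]) auto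
qed

lemma vector_norm_unit:
  assumes "vector_norm \<nu>"
  obtains u where "\<nu> u = 1"
proof -
  have nz: "\<nu> (axis undefined 1) \<noteq> 0" using assms by (simp add: vector_norm_def axis_eq_0_iff)
  moreover have "\<nu> (axis undefined 1) \<ge> 0" using assms by (simp add: vector_norm_def)
  moreover have "\<nu> (of_real (1 / \<nu> (axis undefined 1)) *s axis undefined 1)
     = cmod (of_real (1 / \<nu> (axis undefined 1))) * \<nu> (axis undefined 1)"
    using assms unfolding vector_norm_def by blast
  ultimately show ?thesis by (intro that[of "of_real (1 / \<nu> (axis undefined 1)) *s axis undefined 1"]) (simp del: of_real_divide)
qed

lemma induced_norm_bound:
  fixes \<nu> :: "complex ^ 'n \<Rightarrow> real" and A :: "complex ^ 'n ^ 'n"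
  assumes \<nu>: "vector_norm \<nu>"
  shows "\<nu> (A *v x) \<le> induced_norm \<nu> A * \<nu> x"
proof (cases "x = 0")
  case True
  have "\<nu> 0 = 0" using \<nu> by (simp add: vector_norm_def)
  then show ?thesis using True by simp
next
  case False
  have nn: "0 \<le> \<nu> x" and nz: "\<nu> x = 0 \<longleftrightarrow> x = 0" and hom: "\<nu> (c *s x) = cmod c * \<nu> x"
    and tri: "\<nu> (x + y) \<le> \<nu> x + \<nu> y" for c x y
    using \<nu> by (auto simp: vector_norm_def)
  have linear: "A *v (c *s x) = c *s (A *v x)" for c x by (simp add: vector_scalar_commute)
  obtain C where C: "C > 0" "\<And>x. norm x \<le> C * \<nu> x" using norm_le_vector_norm[OF \<nu>] by blast
  \<comment> \<open>The real supremum dominates its members only for a bounded set, so boundedness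
    comes before the norm inequality. Here x \<mapsto> \<nu> (A *v x) is merely a seminorm.\<close>
  have "bdd_above ((\<lambda>x. \<nu> (A *v x)) ` {x. \<nu> x = 1})"
  proof (rule bdd_aboveI2)
    fix x assume "x \<in> {x. \<nu> x = 1}"
    then have "norm x \<le> C" using C(2)[of x] by simp
    have "\<nu> (A *v x) \<le> norm x * (\<Sum>i\<in>UNIV. \<nu> (A *v axis i 1))"
      by (rule seminorm_le_norm) (simp_all add: linear hom nn tri matrix_vector_right_distrib)
    also have "\<dots> \<le> C * (\<Sum>i\<in>UNIV. \<nu> (A *v axis i 1))"
      by (intro mult_right_mono \<open>norm x \<le> C\<close> sum_nonneg nn)
    finally show "\<nu> (A *v x) \<le> C * (\<Sum>i\<in>UNIV. \<nu> (A *v axis i 1))" .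
  qed
  moreover define v where "v = of_real (1 / \<nu> x) *s x"
  have pos: "\<nu> x > 0" using nn[of x] nz[of x] False by linarith
  then have "\<nu> v = 1" unfolding v_def hom norm_of_real by simp
  ultimately have "\<nu> (A *v v) \<le> induced_norm \<nu> A"
    unfolding induced_norm_def by (intro cSUP_upper) auto
  then show ?thesis unfolding v_def linear hom norm_of_real using pos by (simp add: field_simps)
qed

lemma induced_norm_le:
  assumes "vector_norm \<nu>" and "\<And>x. \<nu> (A *v x) \<le> C * \<nu> x"
  shows "induced_norm \<nu> A \<le> C"
proof -
  obtain u where "\<nu> u = 1" using vector_norm_unit[OF assms(1)] .
  then show ?thesis unfolding induced_norm_def
    by (intro cSUP_least) (use assms(2) in \<open>auto, metis mult_1_right\<close>)
qed

lemma induced_norm_nonneg: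
  assumes "vector_norm \<nu>"
  shows "0 \<le> induced_norm \<nu> A"
proof -
  obtain u where "\<nu> u = 1" using vector_norm_unit[OF assms] .
  then have "\<nu> (A *v u) \<le> induced_norm \<nu> A" using induced_norm_bound[OF assms, of A u] by simp
  moreover have "0 \<le> \<nu> (A *v u)" using assms by (simp add: vector_norm_def)
  ultimately show ?thesis by linarith
qed

text \<open>The hypothesis on diagonal matrices in the coordinatewise form in which the propagators
  use it.\<close>

lemma diagonal_bound:
  fixes \<nu> :: "complex ^ 'n \<Rightarrow> real"
  assumes \<nu>: "vector_norm \<nu>"
    and diag: "\<And>E. diagonal_matrix E \<Longrightarrow> induced_norm \<nu> E \<le> Max (range (\<lambda>i. cmod (E $ i $ i)))"
    and e: "\<And>i. cmod (e i) \<le> C"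
  shows "\<nu> (\<chi> i. e i * v $ i) \<le> C * \<nu> v"
proof -
  define E :: "complex ^ 'n ^ 'n" where "E = (\<chi> i j. if i = j then e i else 0)"
  have "induced_norm \<nu> E \<le> Max (range (\<lambda>i. cmod (E $ i $ i)))"
    by (rule diag) (simp add: diagonal_matrix_def E_def)
  also have "\<dots> \<le> C" using e by (simp add: E_def)
  finally have "induced_norm \<nu> E \<le> C" .
  have "E *v v = (\<chi> i. e i * v $ i)"
    by (simp add: E_def matrix_vector_mult_def vec_eq_iff if_distrib[where f = "\<lambda>x. x * _"] cong: if_cong)
  then have "\<nu> (\<chi> i. e i * v $ i) \<le> induced_norm \<nu> E * \<nu> v"
    using induced_norm_bound[OF \<nu>, of E v] by simp
  also have "\<dots> \<le> C * \<nu> v"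
    using \<open>induced_norm \<nu> E \<le> C\<close> \<nu> by (intro mult_right_mono) (simp_all add: vector_norm_def)
  finally show ?thesis .
qed

section \<open>Triangularity as a rank function, and the Neumann sum\<close>

lemma strictly_triangular_rank:
  fixes N :: "complex ^ 'n::{finite,linorder} ^ 'n::{finite,linorder}"
  assumes "strictly_triangular N"
  obtains rk :: "'n \<Rightarrow> nat" where "\<And>i. rk i < CARD('n)" "\<And>i j. N $ i $ j \<noteq> 0 \<Longrightarrow> rk i < rk j"
\<comment> \<open>Counting predecessors in the upper case and successors in the lower case makes
  nonzero entries raise the rank, so the two cases need no further distinction.\<close>
proof (cases "\<forall>i j. j \<le> i \<longrightarrow> N $ i $ j = 0")
  case True
  show thesis
  proof (rule that[of "\<lambda>i. card {l. l < i}"])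
    show "card {l. l < i} < CARD('n)" for i :: 'n by (intro psubset_card_mono) auto
    show "card {l. l < i} < card {l. l < j}" if "N $ i $ j \<noteq> 0" for i j
    proof -
      have "i < j" using True that by (meson not_le)
      then show ?thesis by (intro psubset_card_mono) auto
    qed
  qed
next
  case False
  then have lower: "\<forall>i j. i \<le> j \<longrightarrow> N $ i $ j = 0" using assms by (auto simp: strictly_triangular_def)
  show thesis
  proof (rule that[of "\<lambda>i. card {l. i < l}"])
    show "card {l. i < l} < CARD('n)" for i :: 'n by (intro psubset_card_mono) auto
    show "card {l. i < l} < card {l. j < l}" if "N $ i $ j \<noteq> 0" for i j
    proof -
      have "j < i" using lower that by (meson not_le)
      then show ?thesis by (intro psubset_card_mono) auto
    qed
  qed
qed

text \<open>A permutation with nonzero product never lowers the rank, yet it preserves the sum of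
  all ranks. So every rank is preserved, which leaves only the identity.\<close>

lemma det_rank_triangular:
  fixes A :: "'a::comm_ring_1 ^ 'n ^ 'n" and rk :: "'n \<Rightarrow> nat"
  assumes "\<And>i j. A $ i $ j \<noteq> 0 \<Longrightarrow> i = j \<or> rk i < rk j"
  shows "det A = (\<Prod>i\<in>UNIV. A $ i $ i)"
proof -
  have "of_int (sign p) * (\<Prod>i\<in>UNIV. A $ i $ p i) = 0"
    if p: "p permutes UNIV" "p \<noteq> id" for p
  proof (rule ccontr)
    assume "of_int (sign p) * (\<Prod>i\<in>UNIV. A $ i $ p i) \<noteq> 0"
    then have "A $ i $ p i \<noteq> 0" for i
      using prod_zero[of UNIV "\<lambda>i. A $ i $ p i"] by fastforce
    then have cases: "i = p i \<or> rk i < rk (p i)" for i using assms by blast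
    then have le: "rk i \<le> rk (p i)" for i by (metis less_imp_le order_refl)
    have "(\<Sum>i\<in>UNIV. rk i) = (\<Sum>i\<in>UNIV. rk (p i))"
      using sum.permute[OF p(1), of rk] by (simp add: o_def)
    then have "rk i = rk (p i)" for i
      using sum_mono_inv[of rk UNIV "\<lambda>i. rk (p i)" i] le by simp
    then have "p i = i" for i using cases[of i] by simp
    then show False using p(2) by (simp add: fun_eq_iff)
  qed
  then have "det A = (\<Sum>p\<in>{id}. of_int (sign p) * (\<Prod>i\<in>UNIV. A $ i $ p i))"
    unfolding det_def by (intro sum.mono_neutral_right) (auto simp: permutes_id finite_permutations)
  then show ?thesis by (simp add: sign_id)
qed

lemma spectrum_rank_triangular:
  fixes D N :: "complex ^ 'n ^ 'n" and rk :: "'n \<Rightarrow> nat"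
  assumes "diagonal_matrix D" and "\<And>i j. N $ i $ j \<noteq> 0 \<Longrightarrow> rk i < rk j"
  shows "spectrum (D + N) = range (\<lambda>i. D $ i $ i)"
proof -
  have N: "N $ i $ i = 0" for i using assms(2)[of i i] by blast
  have "det (mat z - (D + N)) = (\<Prod>i\<in>UNIV. z - D $ i $ i)" for z
  proof -
    have "det (mat z - (D + N)) = (\<Prod>i\<in>UNIV. (mat z - (D + N)) $ i $ i)"
      by (rule det_rank_triangular[of _ rk])
        (use assms in \<open>auto simp: diagonal_matrix_def mat_def split: if_splits\<close>)
    then show ?thesis by (simp add: mat_def N)
  qed
  then show ?thesis by (auto simp: spectrum_def invertible_det_nz)
qed

text \<open>Entrywise, so that each step is a linear combination divided by one z - d, the operation
  that \<open>green_division\<close> transforms.\<close>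

primrec resolvent_term :: "complex ^ 'n ^ 'n \<Rightarrow> complex ^ 'n ^ 'n \<Rightarrow> nat \<Rightarrow> complex \<Rightarrow> complex ^ 'n ^ 'n" where
  "resolvent_term D N 0 z = (\<chi> i j. if i = j then 1 / (z - D $ i $ i) else 0)"
| "resolvent_term D N (Suc k) z = (\<chi> i j. (\<Sum>l\<in>UNIV. N $ i $ l * resolvent_term D N k z $ l $ j) / (z - D $ i $ i))"

text \<open>Each of the k factors \<open>N\<close> raises the rank by at least one.\<close>

lemma resolvent_term_eq_0:
  fixes D N :: "complex ^ 'n ^ 'n" and rk :: "'n \<Rightarrow> nat"
  assumes "\<And>i j. N $ i $ j \<noteq> 0 \<Longrightarrow> rk i < rk j" and "rk j < rk i + k"
  shows "resolvent_term D N k z $ i $ j = 0"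
  using assms(2)
proof (induction k arbitrary: i)
  case (Suc k)
  have "N $ i $ l * resolvent_term D N k z $ l $ j = 0" for l
  proof (cases "N $ i $ l = 0")
    case False
    then have "rk i < rk l" by (rule assms(1))
    then show ?thesis using Suc by simp
  qed simp
  then have "(\<Sum>l\<in>UNIV. N $ i $ l * resolvent_term D N k z $ l $ j) = 0" by (intro sum.neutral) blast
  then show ?case by simp
qed auto

lemma matrix_inv_resolvent:
  fixes D N :: "complex ^ 'n ^ 'n" and rk :: "'n \<Rightarrow> nat"
  assumes D: "diagonal_matrix D" and N: "\<And>i j. N $ i $ j \<noteq> 0 \<Longrightarrow> rk i < rk j"
    and n: "\<And>i. rk i < n" and z: "z \<notin> range (\<lambda>i. D $ i $ i)"
  shows "matrix_inv (mat z - (D + N)) = (\<Sum>k<n. resolvent_term D N k z)"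
proof -
  have nz: "z - D $ i $ i \<noteq> 0" for i using z by auto
  define R where "R k i j = resolvent_term D N k z $ i $ j" for k i j
  have R0: "(z - D $ i $ i) * R 0 i j = (if i = j then 1 else 0)" for i j
    using nz[of i] by (auto simp: R_def)
  have RS: "(z - D $ i $ i) * R (Suc k) i j = (\<Sum>l\<in>UNIV. N $ i $ l * R k l j)" for k i j
    using nz[of i] by (simp add: R_def)
  \<comment> \<open>Telescoping: (z - D - N) times the partial sum is the identity minus N times the
    last term.\<close>
  have tel: "(z - D $ i $ i) * (\<Sum>k<Suc m. R k i j) - (\<Sum>l\<in>UNIV. N $ i $ l * (\<Sum>k<Suc m. R k l j))
      = (if i = j then 1 else 0) - (\<Sum>l\<in>UNIV. N $ i $ l * R m l j)" for m i j
  proof (induction m)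
    case 0
    show ?case using R0 by simp
  next
    case (Suc m)
    have "(z - D $ i $ i) * (\<Sum>k<Suc (Suc m). R k i j)
       = (z - D $ i $ i) * (\<Sum>k<Suc m. R k i j) + (\<Sum>l\<in>UNIV. N $ i $ l * R m l j)"
      unfolding RS[symmetric] by (simp add: algebra_simps)
    moreover have "(\<Sum>l\<in>UNIV. N $ i $ l * (\<Sum>k<Suc (Suc m). R k l j))
       = (\<Sum>l\<in>UNIV. N $ i $ l * (\<Sum>k<Suc m. R k l j)) + (\<Sum>l\<in>UNIV. N $ i $ l * R (Suc m) l j)"
      unfolding sum.distrib[symmetric] by (intro sum.cong refl) (simp add: distrib_left)
    moreover have "a' - b' = e - s'" if "a' = a + s" "b' = b + s'" "a - b = e - s"
      for a a' b b' e s s' :: complex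
      using that by (simp add: algebra_simps)
    ultimately show ?case using Suc by blast
  qed
  \<comment> \<open>The term of index n - 1 may be nonzero, but one more factor \<open>N\<close>
    exceeds the available ranks; hence n summands suffice.\<close>
  have last: "N $ i $ l * R (n - 1) l j = 0" for i l j
  proof (cases "N $ i $ l = 0")
    case False
    then have "rk i < rk l" by (rule N)
    then have "rk j < rk l + (n - 1)" using n[of j] by simp
    then show ?thesis using resolvent_term_eq_0[where N = N and rk = rk and i = l and j = j, OF N] by (simp add: R_def)
  qed simp
  have last_sum: "(\<Sum>l\<in>UNIV. N $ i $ l * R (n - 1) l j) = 0" for i j
    using last by (intro sum.neutral) blast
  have "0 < n" using n[of undefined] by simp
  define S where "S = (\<Sum>k<n. resolvent_term D N k z)"
  have S: "S $ i $ j = (\<Sum>k<Suc (n - 1). R k i j)" for i j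
    using \<open>0 < n\<close> by (simp add: S_def R_def)
  have "((mat z - (D + N)) ** S) $ i $ j = mat 1 $ i $ j" for i j
  proof -
    have "(mat z - (D + N)) $ i $ l * S $ l $ j
       = (if i = l then (z - D $ i $ i) * S $ i $ j else 0) - N $ i $ l * S $ l $ j" for l
      using D by (auto simp: diagonal_matrix_def mat_def algebra_simps)
    then have "((mat z - (D + N)) ** S) $ i $ j = (z - D $ i $ i) * S $ i $ j - (\<Sum>l\<in>UNIV. N $ i $ l * S $ l $ j)"
      by (simp add: matrix_matrix_mult_def sum_subtractf)
    also have "\<dots> = (if i = j then 1 else 0)"
      unfolding S tel last_sum by simp
    finally show ?thesis by (simp add: mat_def)
  qed
  then have right: "(mat z - (D + N)) ** S = mat 1" by (simp add: vec_eq_iff)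
  then have "matrix_inv (mat z - (D + N)) ** (mat z - (D + N)) = mat 1"
    unfolding matrix_inv_def
    by (rule_tac someI2[of _ S]) (auto simp: matrix_left_right_inverse)
  then have "matrix_inv (mat z - (D + N)) = S"
    using right by (metis matrix_mul_assoc matrix_mul_lid matrix_mul_rid)
  then show ?thesis by (simp only: S_def)
qed

section \<open>The estimate\<close>

text \<open>The division step gives only existence, so the sequence is built by dependent choice.
  The term of index 0 jumps at time 0 and is fixed explicitly; the others are controlled by their
  equation, continuity and the decay contained in \<open>green_pair\<close>.\<close>

lemma green_terms_exist:
  fixes D N :: "complex ^ 'n ^ 'n"
  defines "Z \<equiv> range (\<lambda>i. D $ i $ i)"
  assumes Z: "\<And>d. d \<in> Z \<Longrightarrow> Re d \<noteq> 0"
  obtains r :: "nat \<Rightarrow> 'n \<Rightarrow> 'n \<Rightarrow> complex \<Rightarrow> complex" and T :: "nat \<Rightarrow> 'n \<Rightarrow> 'n \<Rightarrow> real \<Rightarrow> complex"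
  where "\<And>k i j. green_pair Z (r k i j) (T k i j)"
    and "\<And>k i j z. z \<notin> Z \<Longrightarrow> r k i j z = resolvent_term D N k z $ i $ j"
    and "\<And>i j t. T 0 i j t = (if i = j then green_scalar_right t (D $ i $ i) else 0)"
    and "\<And>k i j t. t \<noteq> 0 \<Longrightarrow> (T (Suc k) i j has_vector_derivative
           D $ i $ i * T (Suc k) i j t + (\<Sum>l\<in>UNIV. N $ i $ l * T k l j t)) (at t)"
    and "\<And>k i j. continuous_on UNIV (T (Suc k) i j)"
proof -
  define P where "P k X \<longleftrightarrow> (\<forall>i j. green_pair Z (fst X i j) (snd X i j) \<and>
      (\<forall>z. z \<notin> Z \<longrightarrow> fst X i j z = resolvent_term D N k z $ i $ j) \<and>
      (k = 0 \<longrightarrow> snd X i j = (\<lambda>t. if i = j then green_scalar_right t (D $ i $ i) else 0)))"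
    for k and X :: "('n \<Rightarrow> 'n \<Rightarrow> complex \<Rightarrow> complex) \<times> ('n \<Rightarrow> 'n \<Rightarrow> real \<Rightarrow> complex)"
  define Q where "Q X Y \<longleftrightarrow> (\<forall>i j. continuous_on UNIV (snd Y i j) \<and>
      (\<forall>t. t \<noteq> 0 \<longrightarrow> (snd Y i j has_vector_derivative
           D $ i $ i * snd Y i j t + (\<Sum>l\<in>UNIV. N $ i $ l * snd X l j t)) (at t)))"
    for X Y :: "('n \<Rightarrow> 'n \<Rightarrow> complex \<Rightarrow> complex) \<times> ('n \<Rightarrow> 'n \<Rightarrow> real \<Rightarrow> complex)"
  have Di: "D $ i $ i \<in> Z" for i by (simp add: Z_def)
  define r0 :: "'n \<Rightarrow> 'n \<Rightarrow> complex \<Rightarrow> complex" where "r0 i j z = (if i = j then 1 / (z - D $ i $ i) else 0)" for i j z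
  define T0 where "T0 i j t = (if i = j then green_scalar_right t (D $ i $ i) else 0)" for i j t
  have "green_pair Z (r0 i j) (T0 i j)" for i j
    unfolding r0_def T0_def
    using green_pair_base[OF Di[of i], of 0] green_pair_zero[of Z] by (cases "i = j") auto
  then have base: "P 0 (r0, T0)"
    unfolding P_def by (simp add: r0_def T0_def fun_eq_iff)
  have step: "\<exists>Y. P (Suc k) Y \<and> Q X Y" if "P k X" for k X
  proof -
    have "\<exists>r' T'. green_division Z (D $ i $ i) (\<lambda>z. \<Sum>l\<in>UNIV. N $ i $ l * fst X l j z)
        (\<lambda>t. \<Sum>l\<in>UNIV. N $ i $ l * snd X l j t) r' T'" for i j
      by (intro green_division_exists green_pair_sum green_pair_scale Di Z finite_UNIV)
        (use that in \<open>auto simp: P_def\<close>)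
    then have "\<forall>i j. \<exists>r' T'. green_division Z (D $ i $ i) (\<lambda>z. \<Sum>l\<in>UNIV. N $ i $ l * fst X l j z)
        (\<lambda>t. \<Sum>l\<in>UNIV. N $ i $ l * snd X l j t) r' T'"
      by blast
    then have "\<exists>r' T'. \<forall>i j. green_division Z (D $ i $ i) (\<lambda>z. \<Sum>l\<in>UNIV. N $ i $ l * fst X l j z)
        (\<lambda>t. \<Sum>l\<in>UNIV. N $ i $ l * snd X l j t) (r' i j) (T' i j)"
      by (simp only: choice_iff)
    then obtain r' T' where *: "\<And>i j. green_division Z (D $ i $ i) (\<lambda>z. \<Sum>l\<in>UNIV. N $ i $ l * fst X l j z)
        (\<lambda>t. \<Sum>l\<in>UNIV. N $ i $ l * snd X l j t) (r' i j) (T' i j)"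
      by blast
    have "P (Suc k) (r', T')"
      using * that unfolding P_def green_division_def by simp
    moreover have "Q X (r', T')"
      using * unfolding Q_def green_division_def by simp
    ultimately show ?thesis by blast
  qed
  have "\<exists>f. \<forall>k. P k (f k) \<and> Q (f k) (f (Suc k))"
    by (rule dependent_nat_choice) (use base step in blast)+
  then obtain f where f: "\<And>k. P k (f k)" "\<And>k. Q (f k) (f (Suc k))" by blast
  show thesis
    by (rule that[of "\<lambda>k. fst (f k)" "\<lambda>k. snd (f k)"])
      (use f[unfolded P_def Q_def] in \<open>simp_all add: fun_eq_iff\<close>)
qed

theorem theorem4:
  fixes B D N :: "complex ^ 'n::{finite,linorder} ^ 'n::{finite,linorder}"
    and \<gamma>m \<gamma>p \<gamma> :: real
    and \<nu> :: "complex ^ 'n::{finite,linorder} \<Rightarrow> real"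
  assumes "triangular B"
    and "B = D + N"
    and "diagonal_matrix D"
    and "strictly_triangular N"
    and "\<gamma>m > 0" and "\<gamma>p > 0"
    and "{z. - \<gamma>m < Re z \<and> Re z < \<gamma>p} \<inter> spectrum B = {}"
    and "vector_norm \<nu>"
    and "\<And>E. diagonal_matrix E \<Longrightarrow> induced_norm \<nu> E \<le> Max (range (\<lambda>i. cmod (E $ i $ i)))"
    and "\<gamma> = \<gamma>m + \<gamma>p"
  shows "\<forall>t. t \<noteq> 0 \<longrightarrow>
    induced_norm \<nu> (green_function B t) \<le>
      (heaviside t * exp (- \<gamma>m * t) + heaviside (- t) * exp (\<gamma>p * t)) *
      (\<Sum>k = 0..CARD('n) - 1. induced_norm \<nu> N ^ k *
         (\<bar>t\<bar> ^ k * sqrt (\<gamma> * \<bar>t\<bar>) * exp (\<gamma> * \<bar>t\<bar> / 2) * bessel_K (- real k - 1 / 2) (\<gamma> * \<bar>t\<bar> / 2)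
           / (sqrt pi * fact k)))"
proof (intro allI impI)
  fix t :: real assume t: "t \<noteq> 0"
  obtain rk :: "'n \<Rightarrow> nat" where rk: "\<And>i. rk i < CARD('n)" "\<And>i j. N $ i $ j \<noteq> 0 \<Longrightarrow> rk i < rk j"
    using strictly_triangular_rank[OF assms(4)] by blast
  define d where "d i = D $ i $ i" for i
  define Z where "Z = range (\<lambda>i. D $ i $ i)"
  have spec: "spectrum B = Z"
    unfolding assms(2) Z_def by (rule spectrum_rank_triangular[OF assms(3) rk(2)])
  have gap: "Re (d i) \<le> - \<gamma>m \<or> \<gamma>p \<le> Re (d i)" for i
  proof -
    have "d i \<in> spectrum B" by (simp add: spec Z_def d_def)
    then have "\<not> (- \<gamma>m < Re (d i) \<and> Re (d i) < \<gamma>p)" using assms(7) by blast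
    then show ?thesis by linarith
  qed
  have Zre: "Re z \<noteq> 0" if zZ: "z \<in> Z" for z
  proof -
    obtain i where "z = d i" using zZ by (auto simp: Z_def d_def)
    then show ?thesis using gap[of i] assms(5,6) by auto
  qed
  obtain r T where rT: "\<And>k i j. green_pair Z (r k i j) (T k i j)"
    and r: "\<And>k i j z. z \<notin> Z \<Longrightarrow> r k i j z = resolvent_term D N k z $ i $ j"
    and T0: "\<And>i j t. T 0 i j t = (if i = j then green_scalar_right t (D $ i $ i) else 0)"
    and T_der: "\<And>k i j t. t \<noteq> 0 \<Longrightarrow> (T (Suc k) i j has_vector_derivative
           D $ i $ i * T (Suc k) i j t + (\<Sum>l\<in>UNIV. N $ i $ l * T k l j t)) (at t)"
    and T_cont: "\<And>k i j. continuous_on UNIV (T (Suc k) i j)"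
  proof (rule green_terms_exist[of D N, folded Z_def, OF Zre], goal_cases)
    case (2 r T)
    show ?case by (rule 2(1)[OF 2(2-6)])
  qed
  define \<Gamma> where "\<Gamma> = (SOME \<Gamma>. green_contour B \<Gamma>)"
  have "finite (spectrum B)" by (simp add: spec Z_def)
  then have \<Gamma>: "green_contour B \<Gamma>"
    unfolding \<Gamma>_def using green_contour_exists Zre spec by (metis someI_ex)
  have \<Gamma>_path: "valid_path p \<and> pathfinish p = pathstart p \<and> path_image p \<inter> {z. Re z = 0} = {}" if "p \<in> set \<Gamma>" for p
    using \<Gamma> that unfolding green_contour_def positively_oriented_contour_def contour_image_def by blast
  have \<Gamma>_Z: "Re z \<noteq> 0 \<and> z \<notin> contour_image \<Gamma> \<and> contour_winding \<Gamma> z = 1" if "z \<in> Z" for z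
    using \<Gamma> that Zre spec unfolding green_contour_def enclosed_region_def by blast
  have green: "green_function B t = (\<chi> i j. \<Sum>k<CARD('n). T k i j t)"
  proof -
    have "1 / (2 * of_real pi * \<i>) * (\<Sum>p\<leftarrow>\<Gamma>. contour_integral p (\<lambda>z. green_scalar t z * matrix_inv (mat z - B) $ i $ j))
       = (\<Sum>k<CARD('n). T k i j t)" for i j
    proof -
      have "(\<Sum>p\<leftarrow>\<Gamma>. contour_integral p (\<lambda>z. green_scalar t z * matrix_inv (mat z - B) $ i $ j))
        = (\<Sum>p\<leftarrow>\<Gamma>. contour_integral p (\<lambda>z. green_scalar t z * (\<Sum>k<CARD('n). r k i j z)))"
      \<comment> \<open>The contour avoids \<open>Z\<close>, so agreement of the rational functions
        with the resolvent off the poles is enough.\<close>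
      proof (intro arg_cong[where f = sum_list] map_cong refl contour_integral_cong)
        fix p z assume "p \<in> set \<Gamma>" "z \<in> path_image p"
        then have "z \<notin> Z" using \<Gamma>_Z by (auto simp: contour_image_def)
        then show "green_scalar t z * matrix_inv (mat z - B) $ i $ j = green_scalar t z * (\<Sum>k<CARD('n). r k i j z)"
          unfolding assms(2) by (simp add: matrix_inv_resolvent[OF assms(3) rk(2) rk(1)] Z_def r)
      qed
      also have "\<dots> = 2 * of_real pi * \<i> * (\<Sum>k<CARD('n). T k i j t)"
        by (rule contour_integral_green_pair[OF green_pair_sum[OF finite_lessThan rT] \<Gamma>_path \<Gamma>_Z t, THEN conjunct2])
      finally show ?thesis by simp
    qed
    then show ?thesis unfolding green_function_def Let_def \<Gamma>_def[symmetric] by simp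
  qed
  define P where "P = induced_norm \<nu> N"
  have P: "P \<ge> 0" unfolding P_def by (rule induced_norm_nonneg[OF assms(8)])
  note diag = diagonal_bound[OF assms(8,9)]
  have bound: "\<nu> (\<chi> i. \<Sum>j\<in>UNIV. T k i j s * x $ j) \<le> P ^ k * \<nu> x * green_h \<gamma>m \<gamma>p k s" if "s \<noteq> 0" for k s x
    using that
  proof (induction k arbitrary: s)
    case 0
    have "(\<Sum>j\<in>UNIV. T 0 i j s * x $ j) = green_scalar_right s (d i) * x $ i" for i
      by (simp add: T0 d_def if_distrib[where f = "\<lambda>x. x * _"] cong: if_cong)
    \<comment> \<open>\<open>green_q\<close> of index 0 is 1, so the majorant is the bare two-sided
      exponential and the gap suffices.\<close>
    moreover have "cmod (green_scalar_right s (d i)) \<le> green_h \<gamma>m \<gamma>p 0 s" for i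
    proof -
      have "Re (d i) * s \<le> - \<gamma>m * s" if "s > 0" "Re (d i) < 0"
        using gap[of i] that assms(6) by (intro mult_right_mono) auto
      moreover have "Re (d i) * s \<le> \<gamma>p * s" if "s < 0" "Re (d i) > 0"
        using gap[of i] that assms(5) by (intro mult_right_mono_neg) auto
      ultimately show ?thesis using 0
        by (auto simp: green_scalar_right_def green_h_def green_q_def)
    qed
    ultimately show ?case
      using diag[of "\<lambda>i. green_scalar_right s (d i)" "green_h \<gamma>m \<gamma>p 0 s" x] by (simp add: mult.commute)
  next
    case (Suc k)
    define y where "y k s = (\<chi> i. \<Sum>j\<in>UNIV. T k i j s * x $ j)" for k s
    \<comment> \<open>The new factor \<open>P\<close> is the cost of the matrix \<open>N\<close> in
      the source; the rest is the constant of the induction hypothesis.\<close>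
    have "\<nu> (y (Suc k) s) \<le> (P * (P ^ k * \<nu> x)) * green_h \<gamma>m \<gamma>p (Suc k) s"
    proof (rule dichotomy_bound[where w = "\<lambda>s. N *v y k s" and d = d, OF assms(8) diag gap])
      show "((\<lambda>s. y (Suc k) s $ i) has_vector_derivative d i * y (Suc k) s $ i + (N *v y k s) $ i) (at s)"
        if "s \<noteq> 0" for i s
      proof -
        have "((\<lambda>s. \<Sum>j\<in>UNIV. T (Suc k) i j s * x $ j) has_vector_derivative
          (\<Sum>j\<in>UNIV. (D $ i $ i * T (Suc k) i j s + (\<Sum>l\<in>UNIV. N $ i $ l * T k l j s)) * x $ j)) (at s)"
          by (intro has_vector_derivative_sum has_vector_derivative_mult_left T_der that)
        moreover have "(\<Sum>j\<in>UNIV. (\<Sum>l\<in>UNIV. N $ i $ l * T k l j s) * x $ j) = (N *v y k s) $ i"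
          unfolding y_def matrix_vector_mult_def sum_distrib_right
          by (subst sum.swap) (simp add: sum_distrib_left mult.assoc)
        ultimately show ?thesis
          by (simp add: y_def d_def distrib_right sum.distrib sum_distrib_left mult.assoc)
      qed
      show "continuous_on UNIV (\<lambda>s. y (Suc k) s $ i)" for i
        unfolding y_def by (simp, intro continuous_intros T_cont)
      have "((\<lambda>s. \<Sum>j\<in>UNIV. T (Suc k) i j s * x $ j) \<longlongrightarrow> (\<Sum>j\<in>UNIV. 0 * x $ j)) F"
        if "F = at_bot \<or> F = at_top" for i F
        using that by (intro tendsto_intros) (auto intro: green_pair_lim[OF rT Zre])
      then show "((\<lambda>s. y (Suc k) s $ i) \<longlongrightarrow> 0) at_bot" "((\<lambda>s. y (Suc k) s $ i) \<longlongrightarrow> 0) at_top" for i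
        by (simp_all add: y_def)
      show "\<nu> (N *v y k s) \<le> P * (P ^ k * \<nu> x) * green_h \<gamma>m \<gamma>p k s" if "s \<noteq> 0" for s
      proof -
        have "\<nu> (N *v y k s) \<le> P * \<nu> (y k s)" unfolding P_def by (rule induced_norm_bound[OF assms(8)])
        also have "\<dots> \<le> P * (P ^ k * \<nu> x * green_h \<gamma>m \<gamma>p k s)"
          using Suc.IH[OF that] P by (intro mult_left_mono) (simp_all add: y_def)
        finally show ?thesis by (simp add: mult.assoc)
      qed
    qed (use assms Suc in auto)
    then show ?case by (simp add: y_def mult.assoc)
  qed
  have "induced_norm \<nu> (green_function B t) \<le> (\<Sum>k<CARD('n). P ^ k * green_h \<gamma>m \<gamma>p k t)"
  proof (rule induced_norm_le[OF assms(8)])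
    fix x
    have sub: "\<nu> (\<Sum>k<CARD('n). f k) \<le> (\<Sum>k<CARD('n). \<nu> (f k))" for f
      by (rule subadditive_sum_le) (use assms(8) in \<open>auto simp: vector_norm_def\<close>)
    have "(\<Sum>j\<in>UNIV. (\<Sum>k<CARD('n). T k i j t) * x $ j) = (\<Sum>k<CARD('n). \<Sum>j\<in>UNIV. T k i j t * x $ j)" for i
      unfolding sum_distrib_right by (rule sum.swap)
    then have "green_function B t *v x = (\<Sum>k<CARD('n). \<chi> i. \<Sum>j\<in>UNIV. T k i j t * x $ j)"
      unfolding green matrix_vector_mult_def
      by (simp add: vec_eq_iff)
    then have "\<nu> (green_function B t *v x) \<le> (\<Sum>k<CARD('n). \<nu> (\<chi> i. \<Sum>j\<in>UNIV. T k i j t * x $ j))"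
      using sub by simp
    also have "\<dots> \<le> (\<Sum>k<CARD('n). P ^ k * \<nu> x * green_h \<gamma>m \<gamma>p k t)"
      by (intro sum_mono bound t)
    also have "\<dots> = (\<Sum>k<CARD('n). P ^ k * green_h \<gamma>m \<gamma>p k t) * \<nu> x"
      unfolding sum_distrib_right by (intro sum.cong refl) (simp only: mult_ac)
    finally show "\<nu> (green_function B t *v x) \<le> (\<Sum>k<CARD('n). P ^ k * green_h \<gamma>m \<gamma>p k t) * \<nu> x" .
  qed
  also have "\<dots> = (\<Sum>k = 0..CARD('n) - 1. P ^ k * green_h \<gamma>m \<gamma>p k t)"
  proof -
    have "0 < CARD('n)" by simp
    then have "{..<CARD('n)} = {0..CARD('n) - 1}"
      using lessThan_Suc_atMost[of "CARD('n) - 1"] by (simp add: atLeast0AtMost)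
    then show ?thesis by simp
  qed
  also have "\<dots> = (\<Sum>k = 0..CARD('n) - 1. (heaviside t * exp (- \<gamma>m * t) + heaviside (- t) * exp (\<gamma>p * t)) *
     (P ^ k * (\<bar>t\<bar> ^ k * sqrt (\<gamma> * \<bar>t\<bar>) * exp (\<gamma> * \<bar>t\<bar> / 2) * bessel_K (- real k - 1 / 2) (\<gamma> * \<bar>t\<bar> / 2)
           / (sqrt pi * fact k))))"
  proof (intro sum.cong refl)
    fix k
    have "\<gamma> > 0" "\<bar>t\<bar> > 0" using assms(5,6,10) t by auto
    then have "\<bar>t\<bar> ^ k * sqrt (\<gamma> * \<bar>t\<bar>) * exp (\<gamma> * \<bar>t\<bar> / 2) * bessel_K (- real k - 1 / 2) (\<gamma> * \<bar>t\<bar> / 2)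
           / (sqrt pi * fact k) = green_q \<gamma> k \<bar>t\<bar>"
      by (rule green_q_bessel)
    moreover have "green_h \<gamma>m \<gamma>p k t = (heaviside t * exp (- \<gamma>m * t) + heaviside (- t) * exp (\<gamma>p * t)) * green_q \<gamma> k \<bar>t\<bar>"
      using t by (auto simp: green_h_def heaviside_def assms(10))
    ultimately show "P ^ k * green_h \<gamma>m \<gamma>p k t = (heaviside t * exp (- \<gamma>m * t) + heaviside (- t) * exp (\<gamma>p * t)) *
     (P ^ k * (\<bar>t\<bar> ^ k * sqrt (\<gamma> * \<bar>t\<bar>) * exp (\<gamma> * \<bar>t\<bar> / 2) * bessel_K (- real k - 1 / 2) (\<gamma> * \<bar>t\<bar> / 2)
           / (sqrt pi * fact k)))"
      by (simp only: mult.left_commute)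
  qed
  also have "\<dots> = (heaviside t * exp (- \<gamma>m * t) + heaviside (- t) * exp (\<gamma>p * t)) *
     (\<Sum>k = 0..CARD('n) - 1. P ^ k * (\<bar>t\<bar> ^ k * sqrt (\<gamma> * \<bar>t\<bar>) * exp (\<gamma> * \<bar>t\<bar> / 2) * bessel_K (- real k - 1 / 2) (\<gamma> * \<bar>t\<bar> / 2)
           / (sqrt pi * fact k)))"
    by (rule sum_distrib_left[symmetric])
  finally show "induced_norm \<nu> (green_function B t) \<le>
      (heaviside t * exp (- \<gamma>m * t) + heaviside (- t) * exp (\<gamma>p * t)) *
      (\<Sum>k = 0..CARD('n) - 1. induced_norm \<nu> N ^ k *
         (\<bar>t\<bar> ^ k * sqrt (\<gamma> * \<bar>t\<bar>) * exp (\<gamma> * \<bar>t\<bar> / 2) * bessel_K (- real k - 1 / 2) (\<gamma> * \<bar>t\<bar> / 2)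
           / (sqrt pi * fact k)))"
    by (simp only: P_def)
qed

end
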